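(* Let $\mathcal{G}=(V,\mathcal{I},\mathcal{E},\partial)$ be a finite connected non-compact graph without tadpoles, let $(A,B)$ be local boundary conditions on $\mathcal{G}$ such that the matrix $(A,B)$ has maximal rank and $AB^\dagger$ is self-adjoint, and let $\mathsf{k}>0$. For $\underline{n}\in\mathbb{Z}^{|\mathcal{I}|}$ let $$\widehat{S}_{\underline{n}}(\mathsf{k};A,B)=\Big(\frac{\mathsf{k}}{2\pi}\Big)^{|\mathcal{I}|}\int_{[0,2\pi/\mathsf{k}]^{|\mathcal{I}|}}S(\mathsf{k};A,B,\underline{a})\,e^{-i\mathsf{k}\langle\underline{n},\underline{a}\rangle}\,d\underline{a},\qquad \langle\underline{n},\underline{a}\rangle=\sum_{i\in\mathcal{I}}n_ia_i,$$ be the $\underline{n}$-th Fourier coefficient of the scattering matrix. Then for all $e,e'\in\mathcal{E}$ $$[\widehat{S}_{\underline{n}}(\mathsf{k};A,B)]_{e,e'}=\sum_{\mathbf{w}\in\mathcal{W}_{e,e'}(\underline{n})}\widetilde{W}(\mathbf{w};\mathsf{k})$$ if $\mathcal{W}_{e,e'}(\underline{n})$ is nonempty, and $[\widehat{S}_{\underline{n}}(\mathsf{k};A,B)]_{e,e'}=0$ if $\mathcal{W}_{e,e'}(\underline{n})=\emptyset$.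
   Context: **Graph.** $V,\mathcal{I},\mathcal{E}$ are finite sets of vertices, internal lines and external lines, $\mathcal{E}\ne\emptyset$. $\partial$ assigns to each $i\in\mathcal{I}$ an ordered pair $(\partial^-(i),\partial^+(i))$ of vertices and to each $e\in\mathcal{E}$ a vertex $\partial(e)$. No tadpoles: $\partial^-(i)\neq\partial^+(i)$. Multiple lines are allowed. $\mathcal{S}(v)\subset\mathcal{E}\cup\mathcal{I}$ is the set of lines incident with $v$, $\deg(v)=|\mathcal{S}(v)|$. **Scattering matrix.** $\mathcal{K}=\mathcal{K}_{\mathcal{E}}\oplus\mathcal{K}_{\mathcal{I}}^{(-)}\oplus\mathcal{K}_{\mathcal{I}}^{(+)}$ with $\mathcal{K}_{\mathcal{E}}\cong\mathbb{C}^{|\mathcal{E}|}$, $\mathcal{K}_{\mathcal{I}}^{(\pm)}\cong\mathbb{C}^{|\mathcal{I}|}$; $A,B$ are linear maps on $\mathcal{K}$, and $(A,B)$ denotes the matrix with $A$ and $B$ put next to each other. Put $Z(\mathsf{k};A,B,\underline{a})=AX+i\mathsf{k}BY$, $$X=\begin{pmatrix}\mathbb{I}&0&0\\0&\mathbb{I}&\mathbb{I}\\0&e^{i\mathsf{k}\underline{a}}&e^{-i\mathsf{k}\underline{a}}\end{pmatrix},\qquad Y=\begin{pmatrix}\mathbb{I}&0&0\\0&\mathbb{I}&-\mathbb{I}\\0&-e^{i\mathsf{k}\underline{a}}&e^{-i\mathsf{k}\underline{a}}\end{pmatrix},$$ with $e^{\pm i\mathsf{k}\underline{a}}=\mathrm{diag}(e^{\pm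 i\mathsf{k}a_i})$. For $\mathsf{k}>0$, $\underline{a}\in\mathbb{R}^{|\mathcal{I}|}$, the scattering matrix $S(\mathsf{k};A,B,\underline{a}):\mathcal{K}_{\mathcal{E}}\to\mathcal{K}_{\mathcal{E}}$ is the first component, which is uniquely determined, of any solution $(S,\alpha,\beta)^T$ of $Z(\mathsf{k};A,B,\underline{a})(S,\alpha,\beta)^T=-(A-i\mathsf{k}B)(\mathbb{I},0,0)^T$ (solutions always exist). **Local boundary conditions.** $\mathcal{K}=\bigoplus_{v\in V}\mathcal{L}_v$, where $\mathcal{L}_v$ is spanned by the canonical basis vectors attached to $v$: those of $\mathcal{K}_{\mathcal{E}}$ for $e$ with $\partial(e)=v$, those of $\mathcal{K}_{\mathcal{I}}^{(-)}$ for $i$ with $\partial^-(i)=v$, and those of $\mathcal{K}_{\mathcal{I}}^{(+)}$ for $i$ with $\partial^+(i)=v$. As there are no tadpoles, this basis of $\mathcal{L}_v$ is naturally indexed by $\mathcal{S}(v)$. $(A,B)$ is local if there are an invertible $C$ on $\mathcal{K}$ and linear maps $A_v,B_v$ on $\mathcal{L}_v$ with $CA=\bigoplus_vA_v$ and $CB=\bigoplus_vB_v$. Put $S_v(\mathsf{k})=-(A_v+i\mathsf{k}B_v)^{-1}(A_v-i\mathsf{k}B_v)$, with matrix elements $[S_v(\mathsf{k})]_{j_1,j_2}$, $j_1,j_2\in\mathcal{S}(v)$. **Walks.** A nontrivial walk from $e'$ to $e$ is a sequence $\mathbf{w}=\{e',i_1,\dots,i_N,e\}$, $N\ge1$, $i_p\in\mathcal{I}$,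 for which there are vertices $v_0,\dots,v_N$ with $v_0=\partial(e')\in\partial(i_1)$, $v_N=\partial(e)\in\partial(i_N)$, $v_p\in\partial(i_p)\cap\partial(i_{p+1})$ for $1\le p\le N-1$, and $v_p\neq v_{p+1}$ for $0\le p\le N-1$ (these vertices are unique). A trivial walk is $\{e',e\}$ with $\partial(e)=\partial(e')$. The score $\underline{n}(\mathbf{w})=\{n_i(\mathbf{w})\}_{i\in\mathcal{I}}$ counts how many times each internal line is traversed (zero for trivial walks). $\mathcal{W}_{e,e'}(\underline{n})$ is the set of walks from $e'$ to $e$ with score $\underline{n}$. Weights: $\widetilde{W}(\mathbf{w};\mathsf{k})=[S_{v_N}(\mathsf{k})]_{e,i_N}\prod_{p=1}^{N-1}[S_{v_p}(\mathsf{k})]_{i_{p+1},i_p}[S_{v_0}(\mathsf{k})]_{i_1,e'}$ for nontrivial walks and $\widetilde{W}(\mathbf{w};\mathsf{k})=[S_v(\mathsf{k})]_{e,e'}$ with $v=\partial(e)=\partial(e')$ for trivial ones. *)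

theory Defs
  imports "HOL-Analysis.Analysis" "HOL-Library.Function_Algebras" "Graph_Theory.Digraph_Component"
begin

section \<open>Graphs with external lines\<close>

text \<open>
  \<open>arcs (internal G)\<close> is the set of internal lines, and an internal line \<open>i\<close> has the ordered pair
  of end points \<open>(tail (internal G) i, head (internal G) i)\<close>, i.e. the pair of \<open>\<partial>\<^sup>-(i)\<close>
  and \<open>\<partial>\<^sup>+(i)\<close>. Multiple lines are allowed, and there may be no internal lines at all. Carrier
  sets are used because the set of internal lines may be empty.
\<close>

record ('v, 'i, 'e) line_graph =
  internal :: "('v, 'i) pre_digraph"
  external :: "'e set"
  attach :: "'e \<Rightarrow> 'v"

definition no_tadpole_graph :: "('v, 'i, 'e) line_graph \<Rightarrow> bool" where
  "no_tadpole_graph G \<longleftrightarrow>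
     fin_digraph (internal G) \<and> loopfree_digraph (internal G) \<and>
     finite (external G) \<and> attach G ` external G \<subseteq> verts (internal G)"

text \<open>Two vertices are adjacent only through internal lines, whatever their orientation.\<close>

definition connected_graph :: "('v, 'i, 'e) line_graph \<Rightarrow> bool" where
  "connected_graph G \<longleftrightarrow> Digraph_Component.connected (internal G)"

definition noncompact_graph :: "('v, 'i, 'e) line_graph \<Rightarrow> bool" where
  "noncompact_graph G \<longleftrightarrow> external G \<noteq> {}"

definition end_points :: "('v, 'i, 'e) line_graph \<Rightarrow> 'i \<Rightarrow> 'v set" where
  "end_points G i = {tail (internal G) i, head (internal G) i}"

section \<open>Matrices indexed by finite sets\<close>

text \<open>
  A matrix with rows indexed by \<open>R\<close> and columns indexed by \<open>C\<close> is a function whose values outside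
  \<open>R \<times> C\<close> are irrelevant; the index sets are passed explicitly.
\<close>

type_synonym ('r, 'c) cmat = "'r \<Rightarrow> 'c \<Rightarrow> complex"

definition mat_eq :: "'r set \<Rightarrow> 'c set \<Rightarrow> ('r, 'c) cmat \<Rightarrow> ('r, 'c) cmat \<Rightarrow> bool" where
  "mat_eq R C M N \<longleftrightarrow> (\<forall>r\<in>R. \<forall>c\<in>C. M r c = N r c)"

definition mat_id :: "('r, 'r) cmat" where
  "mat_id r c = (if r = c then 1 else 0)"

definition mat_mul :: "'m set \<Rightarrow> ('r, 'm) cmat \<Rightarrow> ('m, 'c) cmat \<Rightarrow> ('r, 'c) cmat" where
  "mat_mul K M N r c = (\<Sum>m\<in>K. M r m * N m c)"

definition mat_adj :: "('r, 'c) cmat \<Rightarrow> ('c, 'r) cmat" where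
  "mat_adj M c r = cnj (M r c)"

definition self_adjoint :: "'r set \<Rightarrow> ('r, 'r) cmat \<Rightarrow> bool" where
  "self_adjoint K M \<longleftrightarrow> mat_eq K K (mat_adj M) M"

definition is_mat_inv :: "'r set \<Rightarrow> ('r, 'r) cmat \<Rightarrow> ('r, 'r) cmat \<Rightarrow> bool" where
  "is_mat_inv K M N \<longleftrightarrow>
     mat_eq K K (mat_mul K M N) mat_id \<and> mat_eq K K (mat_mul K N M) mat_id"

definition mat_invertible :: "'r set \<Rightarrow> ('r, 'r) cmat \<Rightarrow> bool" where
  "mat_invertible K M \<longleftrightarrow> (\<exists>N. is_mat_inv K M N)"

definition mat_inverse :: "'r set \<Rightarrow> ('r, 'r) cmat \<Rightarrow> ('r, 'r) cmat" where
  "mat_inverse K M = (SOME N. is_mat_inv K M N)"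

text \<open>\<open>(A, B)\<close>: the matrices \<open>A\<close> and \<open>B\<close> put next to each other.\<close>

definition mat_beside :: "('r, 'c) cmat \<Rightarrow> ('r, 'd) cmat \<Rightarrow> ('r, 'c + 'd) cmat" where
  "mat_beside A B r = case_sum (A r) (B r)"

text \<open>
  The rank is the dimension of the span of the columns, taken in the complex vector space of
  functions on the row index type.
\<close>

definition mat_rank :: "'r set \<Rightarrow> 'c set \<Rightarrow> ('r, 'c) cmat \<Rightarrow> nat" where
  "mat_rank R C M =
     vector_space.dim (\<lambda>(x :: complex) f r. x * f r)
       ((\<lambda>c r. if r \<in> R then M r c else 0) ` C)"

section \<open>The scattering matrix\<close>

text \<open>
  Labels of the canonical basis of the space \<open>\<K> = \<K>\<^sub>E \<oplus> \<K>\<^sub>I\<^sup>- \<oplus> \<K>\<^sub>I\<^sup>+\<close>.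
\<close>

datatype ('i, 'e) basis = KE 'e | KIm 'i | KIp 'i

definition basis_set :: "('v, 'i, 'e) line_graph \<Rightarrow> ('i, 'e) basis set" where
  "basis_set G = KE ` external G \<union> KIm ` arcs (internal G) \<union> KIp ` arcs (internal G)"

fun X_mat :: "real \<Rightarrow> ('i \<Rightarrow> real) \<Rightarrow> (('i, 'e) basis, ('i, 'e) basis) cmat" where
  "X_mat k a (KE e) (KE e') = mat_id e e'"
| "X_mat k a (KIm i) (KIm j) = mat_id i j"
| "X_mat k a (KIm i) (KIp j) = mat_id i j"
| "X_mat k a (KIp i) (KIm j) = mat_id i j * exp (\<i> * complex_of_real (k * a i))"
| "X_mat k a (KIp i) (KIp j) = mat_id i j * exp (- \<i> * complex_of_real (k * a i))"
| "X_mat k a _ _ = 0"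

fun Y_mat :: "real \<Rightarrow> ('i \<Rightarrow> real) \<Rightarrow> (('i, 'e) basis, ('i, 'e) basis) cmat" where
  "Y_mat k a (KE e) (KE e') = mat_id e e'"
| "Y_mat k a (KIm i) (KIm j) = mat_id i j"
| "Y_mat k a (KIm i) (KIp j) = - mat_id i j"
| "Y_mat k a (KIp i) (KIm j) = - mat_id i j * exp (\<i> * complex_of_real (k * a i))"
| "Y_mat k a (KIp i) (KIp j) = mat_id i j * exp (- \<i> * complex_of_real (k * a i))"
| "Y_mat k a _ _ = 0"

definition Z_mat ::
  "('v, 'i, 'e) line_graph \<Rightarrow> real \<Rightarrow> (('i, 'e) basis, ('i, 'e) basis) cmat \<Rightarrow>
   (('i, 'e) basis, ('i, 'e) basis) cmat \<Rightarrow> ('i \<Rightarrow> real) \<Rightarrow>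
   (('i, 'e) basis, ('i, 'e) basis) cmat" where
  "Z_mat G k A B a p q =
     mat_mul (basis_set G) A (X_mat k a) p q
     + \<i> * complex_of_real k * mat_mul (basis_set G) B (Y_mat k a) p q"

text \<open>
  \<open>T\<close> is the column \<open>(S, \<alpha>, \<beta>)\<^sup>T\<close>: its rows \<open>KE e\<close>, \<open>KIm i\<close>, \<open>KIp i\<close> are those of \<open>S\<close>,
  \<open>\<alpha>\<close> and \<open>\<beta>\<close>. The matrix \<open>\<lambda>p e'. mat_id p (KE e')\<close> is \<open>(\<one>, 0, 0)\<^sup>T\<close>.
\<close>

definition is_scattering_solution ::
  "('v, 'i, 'e) line_graph \<Rightarrow> real \<Rightarrow> (('i, 'e) basis, ('i, 'e) basis) cmat \<Rightarrow>
   (('i, 'e) basis, ('i, 'e) basis) cmat \<Rightarrow> ('i \<Rightarrow> real) \<Rightarrow>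
   (('i, 'e) basis, 'e) cmat \<Rightarrow> bool" where
  "is_scattering_solution G k A B a T \<longleftrightarrow>
     mat_eq (basis_set G) (external G)
       (mat_mul (basis_set G) (Z_mat G k A B a) T)
       (\<lambda>p e'. - mat_mul (basis_set G)
                    (\<lambda>p q. A p q - \<i> * complex_of_real k * B p q)
                    (\<lambda>p e'. mat_id p (KE e')) p e')"

text \<open>
  \<open>Z\<close> may be singular, so that \<open>T\<close> need not be unique; its first component, which is all that is
  used, does not depend on the choice.
\<close>

definition scattering_matrix ::
  "('v, 'i, 'e) line_graph \<Rightarrow> real \<Rightarrow> (('i, 'e) basis, ('i, 'e) basis) cmat \<Rightarrow>
   (('i, 'e) basis, ('i, 'e) basis) cmat \<Rightarrow> ('i \<Rightarrow> real) \<Rightarrow> ('e, 'e) cmat" where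
  "scattering_matrix G k A B a =
     (\<lambda>e e'. (SOME T. is_scattering_solution G k A B a T) (KE e) e')"

text \<open>
  The integral is with respect to Lebesgue measure on \<open>\<real>\<^bsup>I\<^esup>\<close>, \<open>I\<close> the set of internal lines,
  that is the completion of the product Borel measure; for \<open>I = {}\<close> this is a point mass, and the
  coefficient is the scattering matrix itself.
\<close>

definition fourier_coefficient ::
  "('v, 'i, 'e) line_graph \<Rightarrow> real \<Rightarrow> (('i, 'e) basis, ('i, 'e) basis) cmat \<Rightarrow>
   (('i, 'e) basis, ('i, 'e) basis) cmat \<Rightarrow> ('i \<Rightarrow> int) \<Rightarrow> ('e, 'e) cmat" where
  "fourier_coefficient G k A B n e e' =
     complex_of_real ((k / (2 * pi)) ^ card (arcs (internal G))) *
     (LINT a : (\<Pi>\<^sub>E i\<in>arcs (internal G). {0..2 * pi / k})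
             | completion (\<Pi>\<^sub>M i\<in>arcs (internal G). lborel).
        scattering_matrix G k A B a e e' *
        exp (- \<i> * complex_of_real (k * (\<Sum>i\<in>arcs (internal G). real_of_int (n i) * a i))))"

section \<open>Local boundary conditions\<close>

fun basis_vertex :: "('v, 'i, 'e) line_graph \<Rightarrow> ('i, 'e) basis \<Rightarrow> 'v" where
  "basis_vertex G (KE e) = attach G e"
| "basis_vertex G (KIm i) = tail (internal G) i"
| "basis_vertex G (KIp i) = head (internal G) i"

definition local_basis :: "('v, 'i, 'e) line_graph \<Rightarrow> 'v \<Rightarrow> ('i, 'e) basis set" where
  "local_basis G v = {p \<in> basis_set G. basis_vertex G p = v}"

definition vertex_sum ::
  "('v, 'i, 'e) line_graph \<Rightarrow> ('v \<Rightarrow> (('i, 'e) basis, ('i, 'e) basis) cmat) \<Rightarrow>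
   (('i, 'e) basis, ('i, 'e) basis) cmat" where
  "vertex_sum G M p q =
     (if basis_vertex G p = basis_vertex G q then M (basis_vertex G p) p q else 0)"

text \<open>
  \<open>(A, B)\<close> is local if this holds for some \<open>C\<close>, \<open>Av\<close>, \<open>Bv\<close>. These are arguments because the vertex
  scattering matrices below are formed from \<open>Av\<close> and \<open>Bv\<close>.
\<close>

definition local_bc ::
  "('v, 'i, 'e) line_graph \<Rightarrow> (('i, 'e) basis, ('i, 'e) basis) cmat \<Rightarrow>
   (('i, 'e) basis, ('i, 'e) basis) cmat \<Rightarrow> (('i, 'e) basis, ('i, 'e) basis) cmat \<Rightarrow>
   ('v \<Rightarrow> (('i, 'e) basis, ('i, 'e) basis) cmat) \<Rightarrow>
   ('v \<Rightarrow> (('i, 'e) basis, ('i, 'e) basis) cmat) \<Rightarrow> bool" where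
  "local_bc G A B C Av Bv \<longleftrightarrow>
     mat_invertible (basis_set G) C \<and>
     mat_eq (basis_set G) (basis_set G) (mat_mul (basis_set G) C A) (vertex_sum G Av) \<and>
     mat_eq (basis_set G) (basis_set G) (mat_mul (basis_set G) C B) (vertex_sum G Bv)"

definition vertex_scattering_matrix ::
  "('v, 'i, 'e) line_graph \<Rightarrow> real \<Rightarrow>
   ('v \<Rightarrow> (('i, 'e) basis, ('i, 'e) basis) cmat) \<Rightarrow>
   ('v \<Rightarrow> (('i, 'e) basis, ('i, 'e) basis) cmat) \<Rightarrow> 'v \<Rightarrow>
   (('i, 'e) basis, ('i, 'e) basis) cmat" where
  "vertex_scattering_matrix G k Av Bv v p q =
     - mat_mul (local_basis G v)
         (mat_inverse (local_basis G v) (\<lambda>p q. Av v p q + \<i> * complex_of_real k * Bv v p q))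
         (\<lambda>p q. Av v p q - \<i> * complex_of_real k * Bv v p q) p q"

text \<open>
  The identification of the lines incident with \<open>v\<close> with the canonical basis of \<open>\<L>\<^sub>v\<close>. It
  is meaningful only if the line is incident with \<open>v\<close>, and unambiguous as there are no tadpoles.
\<close>

datatype ('i, 'e) line = ELine 'e | ILine 'i

fun line_basis :: "('v, 'i, 'e) line_graph \<Rightarrow> 'v \<Rightarrow> ('i, 'e) line \<Rightarrow> ('i, 'e) basis" where
  "line_basis G v (ELine e) = KE e"
| "line_basis G v (ILine i) = (if v = tail (internal G) i then KIm i else KIp i)"

section \<open>Walks\<close>

text \<open>
  The walk \<open>{e', i\<^sub>1, \<dots>, i\<^sub>N, e}\<close> is the triple \<open>(e', [i\<^sub>1, \<dots>, i\<^sub>N], e)\<close>, and \<open>vs\<close> lists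
  \<open>v\<^sub>0, \<dots>, v\<^sub>N\<close>. As list positions start at 0, \<open>is ! p\<close> is \<open>i\<^bsub>p+1\<^esub>\<close>, the line between
  \<open>v\<^sub>p\<close> and \<open>v\<^bsub>p+1\<^esub>\<close>. For \<open>N = 0\<close> the conditions say \<open>vs = [\<partial>(e')]\<close> and
  \<open>\<partial>(e) = \<partial>(e')\<close>, i.e. that the walk is trivial.
\<close>

type_synonym ('i, 'e) walk = "'e \<times> 'i list \<times> 'e"

fun walk_vertices :: "('v, 'i, 'e) line_graph \<Rightarrow> ('i, 'e) walk \<Rightarrow> 'v list \<Rightarrow> bool" where
  "walk_vertices G (e', is, e) vs \<longleftrightarrow>
     length vs = length is + 1 \<and>
     vs ! 0 = attach G e' \<and> vs ! length is = attach G e \<and>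
     (\<forall>p < length is.
        vs ! p \<in> end_points G (is ! p) \<and> vs ! (p + 1) \<in> end_points G (is ! p) \<and>
        vs ! p \<noteq> vs ! (p + 1))"

definition walks :: "('v, 'i, 'e) line_graph \<Rightarrow> 'e \<Rightarrow> 'e \<Rightarrow> ('i, 'e) walk set" where
  "walks G e e' =
     {(e', is, e) | is. set is \<subseteq> arcs (internal G) \<and> (\<exists>vs. walk_vertices G (e', is, e) vs)}"

text \<open>
  Since consecutive vertices of a walk differ, every occurrence of an internal line is a traversal.
\<close>

fun score :: "('i, 'e) walk \<Rightarrow> 'i \<Rightarrow> int" where
  "score (e', is, e) i = int (count_list is i)"

definition walks_with_score ::
  "('v, 'i, 'e) line_graph \<Rightarrow> 'e \<Rightarrow> 'e \<Rightarrow> ('i \<Rightarrow> int) \<Rightarrow> ('i, 'e) walk set" where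
  "walks_with_score G e e' n =
     {w \<in> walks G e e'. \<forall>i\<in>arcs (internal G). score w i = n i}"

fun walk_lines :: "('i, 'e) walk \<Rightarrow> ('i, 'e) line list" where
  "walk_lines (e', is, e) = ELine e' # map ILine is @ [ELine e]"

text \<open>
  The factors are \<open>[S\<^bsub>v\<^sub>p\<^esub>]\<close> from the line entering \<open>v\<^sub>p\<close> to the line leaving it, for
  \<open>0 \<le> p \<le> N\<close>; for a trivial walk only \<open>[S\<^bsub>v\<^sub>0\<^esub>]\<close> from \<open>e'\<close> to \<open>e\<close> remains.
\<close>

definition walk_weight ::
  "('v, 'i, 'e) line_graph \<Rightarrow> real \<Rightarrow>
   ('v \<Rightarrow> (('i, 'e) basis, ('i, 'e) basis) cmat) \<Rightarrow>
   ('v \<Rightarrow> (('i, 'e) basis, ('i, 'e) basis) cmat) \<Rightarrow> ('i, 'e) walk \<Rightarrow> complex" where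
  "walk_weight G k Av Bv w =
     (let vs = (THE vs. walk_vertices G w vs); ls = walk_lines w
      in \<Prod>p<length vs.
           vertex_scattering_matrix G k Av Bv (vs ! p)
             (line_basis G (vs ! p) (ls ! (p + 1))) (line_basis G (vs ! p) (ls ! p)))"

end

theory Submission
  imports Defs
begin

text \<open>
  Local boundary conditions make \<open>\<SS> = -(A + ikB)\<^bsup>-1\<^esup>(A - ikB)\<close> the direct sum of the vertex scattering
  matrices, and self-adjointness of \<open>A B\<^sup>\<dagger>\<close> makes it unitary. With \<open>u = (S, \<alpha>, e\<^bsup>-ika\<^esup> \<beta>)\<close> the
  scattering equation becomes the fixed point equation \<open>u = \<SS> (\<iota> + \<tau> u)\<close>, where \<open>\<tau>\<close> moves an
  amplitude along an internal line to its other end, multiplies it by \<open>e\<^bsup>ika\<^esup>\<close> and kills the external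
  amplitudes. Iterating it expands \<open>u\<close> into a sum over walks, a walk with score \<open>n\<close> contributing its
  weight times \<open>e\<^bsup>ik<n,a>\<^esup>\<close>. This Neumann series need not converge absolutely, so \<open>\<tau>\<close> is replaced by
  \<open>r \<tau>\<close> with \<open>r < 1\<close>. As \<open>\<SS>\<close> preserves the norm and \<open>\<tau>\<close> loses exactly the norm of the external
  amplitudes, the external part of the damped solution is bounded by \<open>1/r\<close> and tends to that of \<open>u\<close>
  as \<open>r \<rightarrow> 1\<close>, for every \<open>a\<close>, even where the fixed point equation is singular. Dominated convergence
  then gives the Fourier coefficients.
\<close>

section \<open>Linear algebra over finite index sets\<close>

text \<open>The scaling is the one in \<open>mat_rank\<close>, which gives access to the library
  theory of span and dimension. The constant \<open>fun_dim\<close> is unfolded again where the rank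
  is compared with \<open>fun_space.dim\<close>.\<close>

global_interpretation fun_space: vector_space "\<lambda>(x :: complex) f (r :: 'r). x * f r"
  defines fun_dim = fun_space.dim
  by unfold_locales (auto simp: fun_eq_iff algebra_simps)

text \<open>Either \<open>b\<close> is a combination of the columns \<open>c j\<close>, or a linear
  functional \<open>y\<close> kills all columns but not \<open>b\<close>. The induction adds one
  column at a time. It serves both to invert the boundary matrix and to solve the fixed point
  equation where it is singular.\<close>

lemma fredholm_alternative:
  fixes c :: "'j \<Rightarrow> 'r \<Rightarrow> complex"
  assumes "finite J" and "finite K"
  shows "(\<exists>x. \<forall>r\<in>K. (\<Sum>j\<in>J. x j * c j r) = b r) \<or>
    (\<exists>y. (\<forall>j\<in>J. (\<Sum>r\<in>K. y r * c j r) = 0) \<and> (\<Sum>r\<in>K. y r * b r) \<noteq> 0)"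
  using \<open>finite J\<close>
proof (induction J arbitrary: b)
  case empty
  show ?case
  proof (cases "\<forall>r\<in>K. b r = 0")
    case False
    then obtain r where r: "r \<in> K" "b r \<noteq> 0" by auto
    have "(\<Sum>s\<in>K. (if s = r then 1 else 0) * b s) = b r"
      using r \<open>finite K\<close> by (simp add: if_distrib[of "\<lambda>x. x * _"] cong: if_cong)
    then show ?thesis using r by (intro disjI2 exI[of _ "\<lambda>s. if s = r then 1 else 0"]) auto
  qed auto
next
  case (insert j J)
  define sp where "sp b x \<longleftrightarrow> (\<forall>r\<in>K. (\<Sum>i\<in>J. x i * c i r) = b r)" for b x
  define ip where "ip y b = (\<Sum>r\<in>K. y r * b r)" for y b :: "'r \<Rightarrow> complex"
  have ip_lin: "ip (\<lambda>r. y r + t * z r) b = ip y b + t * ip z b"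
    "ip y (\<lambda>r. b r + t * b' r) = ip y b + t * ip y b'" for y z t b b'
    by (simp_all add: ip_def sum.distrib sum_distrib_left algebra_simps)
  have IH: "(\<exists>x. sp b x) \<or> (\<exists>y. (\<forall>i\<in>J. ip y (c i) = 0) \<and> ip y b \<noteq> 0)" for b
    using insert.IH[of b] by (simp add: sp_def ip_def)
  have in_span: "\<exists>x. \<forall>r\<in>K. (\<Sum>i\<in>insert j J. x i * c i r) = b r"
    if "sp (\<lambda>r. b r + t * c j r) x" for b t x
  proof (intro exI ballI)
    fix r assume "r \<in> K"
    have "(\<Sum>i\<in>J. (x(j := - t)) i * c i r) = (\<Sum>i\<in>J. x i * c i r)"
      using insert.hyps by (intro sum.cong) auto
    then show "(\<Sum>i\<in>insert j J. (x(j := - t)) i * c i r) = b r"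
      using that \<open>r \<in> K\<close> insert.hyps by (simp add: sp_def)
  qed
  have goal: ?case if "(\<forall>i\<in>insert j J. ip y (c i) = 0)" "ip y b \<noteq> 0" for y
    using that by (auto simp: ip_def)
  show ?case
  proof (cases "\<exists>x. sp (c j) x")
    case True
    then obtain x0 where x0: "sp (c j) x0" by blast
    from IH[of b] show ?thesis
    proof
      assume "\<exists>x. sp b x"
      then show ?thesis using in_span[of b 0] by auto
    next
      assume "\<exists>y. (\<forall>i\<in>J. ip y (c i) = 0) \<and> ip y b \<noteq> 0"
      then obtain y where y: "\<forall>i\<in>J. ip y (c i) = 0" "ip y b \<noteq> 0" by blast
      \<comment> \<open>The new column is a combination of the old ones with coefficients
        \<open>x0\<close>, so a functional that kills those kills it too.\<close>
      have "ip y (c j) = (\<Sum>r\<in>K. \<Sum>i\<in>J. y r * (x0 i * c i r))"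
        using x0 by (simp add: ip_def sp_def sum_distrib_left[symmetric])
      also have "\<dots> = (\<Sum>i\<in>J. x0 i * ip y (c i))"
        by (subst sum.swap) (simp add: ip_def sum_distrib_left algebra_simps)
      finally have "ip y (c j) = 0" using y by simp
      then show ?thesis using goal y by simp
    qed
  next
    case False
    then obtain y0 where y0: "\<forall>i\<in>J. ip y0 (c i) = 0" "ip y0 (c j) \<noteq> 0" using IH by blast
    \<comment> \<open>This \<open>t\<close> makes \<open>y0\<close> vanish on
      \<open>b + t * c j\<close>. Hence a multiple of \<open>y0\<close> can be added to
      \<open>y\<close> to kill \<open>c j\<close> without changing the value on
      \<open>b + t * c j\<close>. Once \<open>c j\<close> is killed, that value is the one on
      \<open>b\<close>.\<close>
    define t where "t = - ip y0 b / ip y0 (c j)"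
    from IH[of "\<lambda>r. b r + t * c j r"] show ?thesis
    proof
      assume "\<exists>x. sp (\<lambda>r. b r + t * c j r) x"
      then show ?thesis using in_span by auto
    next
      assume "\<exists>y. (\<forall>i\<in>J. ip y (c i) = 0) \<and> ip y (\<lambda>r. b r + t * c j r) \<noteq> 0"
      then obtain y where y: "\<forall>i\<in>J. ip y (c i) = 0" "ip y b + t * ip y (c j) \<noteq> 0"
        using ip_lin by auto
      define s where "s = - ip y (c j) / ip y0 (c j)"
      have "ip (\<lambda>r. y r + s * y0 r) b = ip y b + t * ip y (c j)"
        unfolding ip_lin using y0 by (simp add: s_def t_def)
      moreover have "ip (\<lambda>r. y r + s * y0 r) (c j) = 0"
        unfolding ip_lin using y0 by (simp add: s_def)
      ultimately show ?thesis
        using y y0 by (intro goal[of "\<lambda>r. y r + s * y0 r"]) (auto simp: ip_lin)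
    qed
  qed
qed

text \<open>If \<open>y r0\<close> were nonzero, every column would lie in the space of vectors
  killed by \<open>y\<close>, which is spanned by fewer than \<open>card R\<close> vectors.\<close>

lemma mat_rank_full_left_kernel:
  fixes M :: "('r, 'c) cmat"
  assumes "finite R" and rank: "mat_rank R C M = card R"
    and ker: "\<And>c. c \<in> C \<Longrightarrow> (\<Sum>r\<in>R. y r * M r c) = 0" and r0: "r0 \<in> R"
  shows "y r0 = 0"
proof (rule ccontr)
  assume y0: "y r0 \<noteq> 0"
  \<comment> \<open>For \<open>r\<close> different from \<open>r0\<close>, \<open>w r\<close> is the
    unit vector at \<open>r\<close>, corrected at \<open>r0\<close> so that \<open>y\<close> kills
    it.\<close>
  define w where "w r = (\<lambda>s. if s = r then 1 else if s = r0 then - y r / y r0 else 0)" for r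
  define V where "V = (\<lambda>c r. if r \<in> R then M r c else 0) ` C"
  have "V \<subseteq> fun_space.span (w ` (R - {r0}))"
  proof
    fix f assume "f \<in> V"
    then obtain c where c: "c \<in> C" "f = (\<lambda>r. if r \<in> R then M r c else 0)" by (auto simp: V_def)
    have "f = (\<Sum>r\<in>R - {r0}. (\<lambda>s. M r c * w r s))"
    proof
      fix s
      have "(\<Sum>r\<in>R - {r0}. (\<lambda>s. M r c * w r s)) s = (\<Sum>r\<in>R - {r0}. M r c * w r s)"
        by (induction rule: infinite_finite_induct) auto
      also have "\<dots> = f s"
      proof (cases "s = r0")
        case True
        have "(\<Sum>r\<in>R - {r0}. M r c * w r s) = (\<Sum>r\<in>R - {r0}. y r * M r c) * (- 1 / y r0)"
          unfolding sum_distrib_right by (rule sum.cong) (auto simp: w_def True)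
        also have "(\<Sum>r\<in>R - {r0}. y r * M r c) = - (y r0 * M r0 c)"
          using ker[OF c(1)] r0 \<open>finite R\<close> by (simp add: sum.remove eq_neg_iff_add_eq_0 add.commute)
        finally show ?thesis using c y0 r0 True by simp
      next
        case False
        have "(\<Sum>r\<in>R - {r0}. M r c * w r s) = (\<Sum>r\<in>R - {r0}. if s = r then M r c else 0)"
          by (rule sum.cong) (use False in \<open>auto simp: w_def\<close>)
        also have "\<dots> = f s" using c False \<open>finite R\<close> by auto
        finally show ?thesis .
      qed
      finally show "f s = (\<Sum>r\<in>R - {r0}. (\<lambda>s. M r c * w r s)) s" ..
    qed
    also have "\<dots> \<in> fun_space.span (w ` (R - {r0}))"
      by (intro fun_space.span_sum fun_space.span_scale fun_space.span_base) auto
    finally show "f \<in> fun_space.span (w ` (R - {r0}))" .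
  qed
  then have "fun_space.dim V \<le> card (w ` (R - {r0}))"
    using \<open>finite R\<close> by (intro fun_space.dim_le_card) auto
  also have "\<dots> \<le> card (R - {r0})" using \<open>finite R\<close> by (intro card_image_le) auto
  also have "\<dots> < card R" using \<open>finite R\<close> r0 by (intro psubset_card_mono) auto
  finally show False using rank by (simp add: mat_rank_def V_def fun_dim_def)
qed


section \<open>Matrix algebra up to equality on the index sets\<close>

lemma mat_eq_refl [simp]: "mat_eq R C M M"
  by (simp add: mat_eq_def)

lemma mat_eq_sym: "mat_eq R C M N \<Longrightarrow> mat_eq R C N M"
  by (simp add: mat_eq_def)

lemma mat_eq_trans [trans]: "mat_eq R C M N \<Longrightarrow> mat_eq R C N P \<Longrightarrow> mat_eq R C M P"
  by (simp add: mat_eq_def)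

lemma mat_eq_mul:
  "mat_eq R K M M' \<Longrightarrow> mat_eq K C N N' \<Longrightarrow> mat_eq R C (mat_mul K M N) (mat_mul K M' N')"
  by (simp add: mat_eq_def mat_mul_def)

lemma mat_mul_assoc: "mat_mul K (mat_mul J M N) P = mat_mul J M (mat_mul K N P)"
proof (intro ext)
  fix r c
  have "mat_mul K (mat_mul J M N) P r c = (\<Sum>m\<in>K. \<Sum>l\<in>J. M r l * (N l m * P m c))"
    by (simp add: mat_mul_def sum_distrib_right mult.assoc)
  also have "\<dots> = mat_mul J M (mat_mul K N P) r c"
    by (subst sum.swap) (simp add: mat_mul_def sum_distrib_left)
  finally show "mat_mul K (mat_mul J M N) P r c = mat_mul J M (mat_mul K N P) r c" .
qed

lemma mat_mul_id_left: "finite K \<Longrightarrow> mat_eq K C (mat_mul K mat_id M) M"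
  by (simp add: mat_eq_def mat_mul_def mat_id_def if_distrib[of "\<lambda>x. x * _"] cong: if_cong)

lemma mat_mul_id_right: "finite K \<Longrightarrow> mat_eq R K (mat_mul K M mat_id) M"
  by (simp add: mat_eq_def mat_mul_def mat_id_def if_distrib[of "\<lambda>x. _ * x"] cong: if_cong)

lemma mat_adj_mul: "mat_adj (mat_mul K M N) = mat_mul K (mat_adj N) (mat_adj M)"
  by (intro ext) (simp add: mat_adj_def mat_mul_def algebra_simps)

lemma mat_adj_id [simp]: "mat_adj mat_id = mat_id"
  by (intro ext) (auto simp: mat_adj_def mat_id_def)

lemma mat_eq_adj: "mat_eq R C M N \<Longrightarrow> mat_eq C R (mat_adj M) (mat_adj N)"
  by (simp add: mat_eq_def mat_adj_def)

text \<open>A kernel vector with \<open>x j\<close> nonzero makes column \<open>j\<close> a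
  combination of the others, while the right inverse writes every unit vector as a combination of
  columns. So \<open>card K\<close> independent vectors would lie in the span of fewer than
  \<open>card K\<close> vectors.\<close>

lemma right_inverse_imp_kernel_trivial:
  fixes M N :: "('r, 'r) cmat"
  assumes "finite K" and inv: "mat_eq K K (mat_mul K M N) mat_id"
    and ker: "\<And>r. r \<in> K \<Longrightarrow> (\<Sum>c\<in>K. M r c * x c) = 0" and j: "j \<in> K"
  shows "x j = 0"
proof (rule ccontr)
  assume xj: "x j \<noteq> 0"
  \<comment> \<open>Columns are cut off outside \<open>K\<close> because vectors are functions on
    the whole type and \<open>M\<close> is arbitrary there.\<close>
  define col where "col c = (\<lambda>r. if r \<in> K then M r c else 0)" for c
  define unit where "unit r = (\<lambda>s :: 'r. if s = r then (1 :: complex) else 0)" for r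
  have sum_app: "(\<Sum>c\<in>F. (\<lambda>s. f c s)) s = (\<Sum>c\<in>F. f c s)"
    for F and f :: "'r \<Rightarrow> 'r \<Rightarrow> complex" and s
    by (induction F rule: infinite_finite_induct) auto
  let ?T = "fun_space.span (col ` (K - {j}))"
  have base: "(\<Sum>c\<in>K - {j}. (\<lambda>s. t c * col c s)) \<in> ?T" for t
    by (intro fun_space.span_sum fun_space.span_scale fun_space.span_base) auto
  have "col j = (\<Sum>c\<in>K - {j}. (\<lambda>s. (- x c / x j) * col c s))"
  proof
    fix s
    show "col j s = (\<Sum>c\<in>K - {j}. (\<lambda>s. (- x c / x j) * col c s)) s"
    proof (cases "s \<in> K")
      case True
      have "(\<Sum>c\<in>K - {j}. (- x c / x j) * M s c) = (\<Sum>c\<in>K - {j}. M s c * x c) * (- 1 / x j)"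
        unfolding sum_distrib_right by (rule sum.cong) auto
      also have "(\<Sum>c\<in>K - {j}. M s c * x c) = - (M s j * x j)"
        using ker[OF True] j \<open>finite K\<close>
        by (simp add: sum.remove eq_neg_iff_add_eq_0 add.commute)
      finally show ?thesis using True xj by (simp add: sum_app col_def)
    qed (simp add: sum_app col_def)
  qed
  then have "col j \<in> ?T" using base by (simp only:)
  then have col: "col c \<in> ?T" if "c \<in> K" for c
    using that by (cases "c = j") (auto intro: fun_space.span_base)
  have "unit r \<in> ?T" if "r \<in> K" for r
  proof -
    have "unit r = (\<Sum>c\<in>K. (\<lambda>s. N c r * col c s))"
    proof
      fix s show "unit r s = (\<Sum>c\<in>K. (\<lambda>s. N c r * col c s)) s"
        using inv that
        by (cases "s \<in> K")
          (auto simp: sum_app unit_def col_def mat_eq_def mat_mul_def mat_id_def mult.commute)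
    qed
    then show ?thesis using col
      by (auto intro!: fun_space.span_sum fun_space.span_scale)
  qed
  then have sub: "unit ` K \<subseteq> ?T" by auto
  have inj: "inj_on unit K" by (auto simp: inj_on_def unit_def fun_eq_iff split: if_splits)
  have "\<not> fun_space.dependent (unit ` K)"
  proof (rule fun_space.independent_if_scalars_zero)
    fix f v assume 0: "(\<Sum>u\<in>unit ` K. (\<lambda>r. f u * u r)) = 0" and "v \<in> unit ` K"
    then obtain r where r: "r \<in> K" "v = unit r" by auto
    have "(\<Sum>u\<in>unit ` K. (\<lambda>r. f u * u r)) r = (\<Sum>s\<in>K. f (unit s) * unit s r)"
      using inj by (subst sum.reindex) (auto simp: sum_app)
    also have "\<dots> = f v" using r \<open>finite K\<close>
      by (simp add: unit_def if_distrib[of "\<lambda>x. _ * x"] cong: if_cong)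
    finally show "f v = 0" using 0 by simp
  qed (use \<open>finite K\<close> in auto)
  from fun_space.independent_span_bound[OF _ this sub] \<open>finite K\<close>
  have "card (unit ` K) \<le> card (col ` (K - {j}))" by auto
  also have "\<dots> \<le> card (K - {j})" using \<open>finite K\<close> by (intro card_image_le) auto
  also have "\<dots> < card K" using \<open>finite K\<close> j by (intro psubset_card_mono) auto
  finally show False using inj by (simp add: card_image)
qed

text \<open>From \<open>M (N M) = M\<close> each column of \<open>N M - 1\<close> lies in the kernel
  of \<open>M\<close>, which is trivial by the preceding lemma.\<close>

lemma right_inverse_imp_left_inverse:
  assumes "finite K" and inv: "mat_eq K K (mat_mul K M N) mat_id"
  shows "mat_eq K K (mat_mul K N M) mat_id"
  unfolding mat_eq_def
proof (intro ballI)
  fix p q assume pq: "p \<in> K" "q \<in> K"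
  have "mat_eq K K (mat_mul K M (mat_mul K N M)) M"
    using mat_eq_trans[OF mat_eq_mul[OF inv mat_eq_refl] mat_mul_id_left[OF \<open>finite K\<close>]]
    by (simp add: mat_mul_assoc)
  moreover have "mat_eq K K (mat_mul K M mat_id) M"
    using \<open>finite K\<close> by (rule mat_mul_id_right)
  ultimately have "(\<Sum>m\<in>K. M r m * (mat_mul K N M m q - mat_id m q)) = 0" if "r \<in> K" for r
    using that pq by (simp add: mat_eq_def mat_mul_def[of K M] algebra_simps sum_subtractf)
  then have "mat_mul K N M p q - mat_id p q = 0"
    by (rule right_inverse_imp_kernel_trivial[where x = "\<lambda>m. mat_mul K N M m q - mat_id m q",
        OF assms _ pq(1)])
  then show "mat_mul K N M p q = mat_id p q" by (rule eq_iff_diff_eq_0[THEN iffD2])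
qed

text \<open>The second case of the Fredholm alternative is excluded, so each unit vector has a
  preimage. These preimages are the columns of a right inverse.\<close>

lemma left_kernel_trivial_imp_inverse:
  assumes "finite K"
    and ker: "\<And>y p. (\<And>q. q \<in> K \<Longrightarrow> (\<Sum>p\<in>K. y p * M p q) = 0) \<Longrightarrow> p \<in> K \<Longrightarrow> y p = 0"
  obtains N where "is_mat_inv K M N"
proof -
  have "\<exists>x. \<forall>p\<in>K. (\<Sum>j\<in>K. x j * M p j) = mat_id p q" for q
  proof -
    have "\<not> (\<exists>y. (\<forall>j\<in>K. (\<Sum>r\<in>K. y r * M r j) = 0) \<and> (\<Sum>r\<in>K. y r * mat_id r q) \<noteq> 0)"
    proof
      assume "\<exists>y. (\<forall>j\<in>K. (\<Sum>r\<in>K. y r * M r j) = 0) \<and> (\<Sum>r\<in>K. y r * mat_id r q) \<noteq> 0"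
      then obtain y where y: "\<And>j. j \<in> K \<Longrightarrow> (\<Sum>r\<in>K. y r * M r j) = 0"
        and nz: "(\<Sum>r\<in>K. y r * mat_id r q) \<noteq> 0" by blast
      have "y r = 0" if "r \<in> K" for r using ker[OF y that] .
      with nz show False by simp
    qed
    then show ?thesis
      using fredholm_alternative[OF assms(1,1), of "\<lambda>j r. M r j" "\<lambda>p. mat_id p q"] by blast
  qed
  then obtain N where N: "\<forall>p\<in>K. (\<Sum>j\<in>K. N q j * M p j) = mat_id p q" for q by metis
  have "mat_eq K K (mat_mul K M (\<lambda>j q. N q j)) mat_id"
    using N by (simp add: mat_eq_def mat_mul_def mult.commute)
  then show ?thesis
    using right_inverse_imp_left_inverse[OF assms(1)] that by (auto simp: is_mat_inv_def)
qed

text \<open>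
  \<open>A B\<^sup>\<dagger>\<close> self-adjoint makes the cross terms cancel in
  \<open>(A \<plusminus> i k B) (A \<plusminus> i k B)\<^sup>\<dagger> = A A\<^sup>\<dagger> + k\<^sup>2 B B\<^sup>\<dagger>\<close>.
\<close>

lemma self_adjoint_gram:
  fixes k :: real
  assumes "self_adjoint K (mat_mul K A (mat_adj B))"
  shows "mat_eq K K
    (mat_mul K (\<lambda>p q. A p q + \<i> * complex_of_real k * B p q)
       (mat_adj (\<lambda>p q. A p q + \<i> * complex_of_real k * B p q)))
    (\<lambda>p q. mat_mul K A (mat_adj A) p q + (complex_of_real k)\<^sup>2 * mat_mul K B (mat_adj B) p q)"
  unfolding mat_eq_def
proof (intro ballI)
  fix p q assume "p \<in> K" "q \<in> K"
  then have "mat_mul K B (mat_adj A) p q = mat_mul K A (mat_adj B) p q"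
    using assms by (simp add: self_adjoint_def mat_eq_def mat_mul_def mat_adj_def algebra_simps)
  moreover have "mat_mul K (\<lambda>p q. A p q + \<i> * complex_of_real k * B p q)
       (mat_adj (\<lambda>p q. A p q + \<i> * complex_of_real k * B p q)) p q
    = mat_mul K A (mat_adj A) p q + (complex_of_real k)\<^sup>2 * mat_mul K B (mat_adj B) p q
      + \<i> * complex_of_real k * (mat_mul K B (mat_adj A) p q - mat_mul K A (mat_adj B) p q)"
    by (simp add: mat_mul_def mat_adj_def sum.distrib sum_subtractf sum_distrib_left
        power2_eq_square algebra_simps)
  ultimately show "mat_mul K (\<lambda>p q. A p q + \<i> * complex_of_real k * B p q)
       (mat_adj (\<lambda>p q. A p q + \<i> * complex_of_real k * B p q)) p q
    = mat_mul K A (mat_adj A) p q + (complex_of_real k)\<^sup>2 * mat_mul K B (mat_adj B) p q"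
    by simp
qed

text \<open>The quadratic form of the Gram matrix of the rows of \<open>M\<close> at
  \<open>y\<close> is the squared norm of the row vector \<open>y M\<close>. It gives positivity for
  the boundary matrix and, later, the isometry property.\<close>

lemma gram_form:
  "(\<Sum>p\<in>K. \<Sum>r\<in>K. y p * cnj (y r) * mat_mul J M (mat_adj M) p r)
    = (\<Sum>q\<in>J. (\<Sum>p\<in>K. y p * M p q) * cnj (\<Sum>p\<in>K. y p * M p q))"
proof -
  have "(\<Sum>q\<in>J. (\<Sum>p\<in>K. y p * M p q) * cnj (\<Sum>p\<in>K. y p * M p q))
    = (\<Sum>q\<in>J. \<Sum>p\<in>K. \<Sum>r\<in>K. y p * cnj (y r) * (M p q * cnj (M r q)))"
    by (simp add: sum_product algebra_simps)
  also have "\<dots> = (\<Sum>p\<in>K. \<Sum>r\<in>K. \<Sum>q\<in>J. y p * cnj (y r) * (M p q * cnj (M r q)))"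
    by (subst sum.swap, rule sum.cong[OF refl], rule sum.swap)
  finally show ?thesis by (simp add: mat_mul_def mat_adj_def sum_distrib_left)
qed

text \<open>If \<open>y (A + ikB) = 0\<close>, the Gram identity gives
  \<open>|yA|^2 + k^2 |yB|^2 = 0\<close>. So \<open>y\<close> kills all columns of
  \<open>(A, B)\<close> and vanishes by maximal rank.\<close>

lemma boundary_matrix_invertible:
  fixes A B :: "('r, 'r) cmat" and k :: real
  assumes "finite K" and "mat_rank K (K <+> K) (mat_beside A B) = card K"
    and sa: "self_adjoint K (mat_mul K A (mat_adj B))" and "k \<noteq> 0"
  obtains N where "is_mat_inv K (\<lambda>p q. A p q + \<i> * complex_of_real k * B p q) N"
proof (rule left_kernel_trivial_imp_inverse[OF \<open>finite K\<close>])
  let ?M = "\<lambda>p q. A p q + \<i> * complex_of_real k * B p q"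
  fix y p
  assume y: "\<And>q. q \<in> K \<Longrightarrow> (\<Sum>p\<in>K. y p * ?M p q) = 0" and p: "p \<in> K"
  let ?a = "\<lambda>q. \<Sum>p\<in>K. y p * A p q" and ?b = "\<lambda>q. \<Sum>p\<in>K. y p * B p q"
  have "0 = (\<Sum>q\<in>K. (\<Sum>p\<in>K. y p * ?M p q) * cnj (\<Sum>p\<in>K. y p * ?M p q))"
    using y by simp
  also have "\<dots> = (\<Sum>p\<in>K. \<Sum>r\<in>K. y p * cnj (y r) * mat_mul K ?M (mat_adj ?M) p r)"
    by (rule gram_form[symmetric])
  also have "\<dots> = (\<Sum>p\<in>K. \<Sum>r\<in>K. y p * cnj (y r) * (mat_mul K A (mat_adj A) p r
      + (complex_of_real k)\<^sup>2 * mat_mul K B (mat_adj B) p r))"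
    using self_adjoint_gram[OF sa, of k] by (intro sum.cong refl) (simp add: mat_eq_def)
  also have "\<dots> = (\<Sum>p\<in>K. \<Sum>r\<in>K. y p * cnj (y r) * mat_mul K A (mat_adj A) p r)
      + (complex_of_real k)\<^sup>2 * (\<Sum>p\<in>K. \<Sum>r\<in>K. y p * cnj (y r) * mat_mul K B (mat_adj B) p r)"
    by (simp add: sum.distrib sum_distrib_left algebra_simps)
  also have "\<dots> = (\<Sum>q\<in>K. ?a q * cnj (?a q)) + (complex_of_real k)\<^sup>2 * (\<Sum>q\<in>K. ?b q * cnj (?b q))"
    by (simp only: gram_form)
  also have "\<dots> = complex_of_real ((\<Sum>q\<in>K. (cmod (?a q))\<^sup>2) + k\<^sup>2 * (\<Sum>q\<in>K. (cmod (?b q))\<^sup>2))"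
    by (simp only: of_real_sum of_real_add of_real_mult of_real_power[of k] complex_norm_square)
  finally have "complex_of_real ((\<Sum>q\<in>K. (cmod (?a q))\<^sup>2) + k\<^sup>2 * (\<Sum>q\<in>K. (cmod (?b q))\<^sup>2)) = 0"
    by (rule sym)
  then have 0: "(\<Sum>q\<in>K. (cmod (?a q))\<^sup>2) + k\<^sup>2 * (\<Sum>q\<in>K. (cmod (?b q))\<^sup>2) = 0"
    by (simp only: of_real_eq_0_iff)
  have "(\<Sum>q\<in>K. (cmod (?a q))\<^sup>2) \<ge> 0" "k\<^sup>2 * (\<Sum>q\<in>K. (cmod (?b q))\<^sup>2) \<ge> 0"
    by (simp_all add: sum_nonneg)
  with 0 have "(\<Sum>q\<in>K. (cmod (?a q))\<^sup>2) = 0" "k\<^sup>2 * (\<Sum>q\<in>K. (cmod (?b q))\<^sup>2) = 0"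
    by linarith+
  then have "\<forall>q\<in>K. ?a q = 0" "\<forall>q\<in>K. ?b q = 0"
    using \<open>finite K\<close> \<open>k \<noteq> 0\<close> by (simp_all add: sum_nonneg_eq_0_iff)
  then have "(\<Sum>p\<in>K. y p * mat_beside A B p c) = 0" if "c \<in> K <+> K" for c
    using that by (auto simp: mat_beside_def)
  then show "y p = 0"
    using mat_rank_full_left_kernel[OF \<open>finite K\<close> assms(2)] p by blast
qed (use that in blast)

section \<open>The direct sum of the vertex scattering matrices\<close>

lemma finite_basis_set: "no_tadpole_graph G \<Longrightarrow> finite (basis_set G)"
  by (simp add: no_tadpole_graph_def basis_set_def fin_digraph.finite_arcs)

lemma vertex_sum_mul:
  assumes "finite (basis_set G)" and "p \<in> basis_set G" and "q \<in> basis_set G"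
  shows "mat_mul (basis_set G) (vertex_sum G M) (vertex_sum G N) p q
    = vertex_sum G (\<lambda>v. mat_mul (local_basis G v) (M v) (N v)) p q"
proof -
  let ?v = "basis_vertex G p"
  have "mat_mul (basis_set G) (vertex_sum G M) (vertex_sum G N) p q
    = (\<Sum>m\<in>local_basis G ?v. vertex_sum G M p m * vertex_sum G N m q)"
    unfolding mat_mul_def using assms(1)
    by (intro sum.mono_neutral_right) (auto simp: local_basis_def vertex_sum_def)
  also have "\<dots> = (\<Sum>m\<in>local_basis G ?v. if ?v = basis_vertex G q then M ?v p m * N ?v m q else 0)"
    by (rule sum.cong) (auto simp: local_basis_def vertex_sum_def)
  also have "\<dots> = vertex_sum G (\<lambda>v. mat_mul (local_basis G v) (M v) (N v)) p q"
    by (auto simp: vertex_sum_def mat_mul_def)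
  finally show ?thesis .
qed

text \<open>The block at \<open>v\<close> is inverted by \<open>N\<close> itself, restricted to
  \<open>local_basis G v\<close>: the block structure of the other factor cuts the sum over the
  basis down to that block.\<close>

lemma vertex_sum_inverse_block:
  assumes "finite (basis_set G)" and inv: "is_mat_inv (basis_set G) (vertex_sum G M) N"
  shows "is_mat_inv (local_basis G v) (M v) N"
proof -
  let ?K = "basis_set G"
  have "mat_mul (local_basis G v) (M v) N p q = mat_id p q"
    "mat_mul (local_basis G v) N (M v) p q = mat_id p q"
    if pq: "p \<in> local_basis G v" "q \<in> local_basis G v" for p q
  proof -
    have "mat_mul ?K (vertex_sum G M) N p q = (\<Sum>m\<in>local_basis G v. vertex_sum G M p m * N m q)"
      unfolding mat_mul_def using assms(1) pq
      by (intro sum.mono_neutral_right) (auto simp: local_basis_def vertex_sum_def)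
    also have "\<dots> = mat_mul (local_basis G v) (M v) N p q"
      unfolding mat_mul_def using pq by (intro sum.cong) (auto simp: local_basis_def vertex_sum_def)
    finally show "mat_mul (local_basis G v) (M v) N p q = mat_id p q"
      using inv pq by (auto simp: is_mat_inv_def mat_eq_def local_basis_def)
    have "mat_mul ?K N (vertex_sum G M) p q = (\<Sum>m\<in>local_basis G v. N p m * vertex_sum G M m q)"
      unfolding mat_mul_def using assms(1) pq
      by (intro sum.mono_neutral_right) (auto simp: local_basis_def vertex_sum_def)
    also have "\<dots> = mat_mul (local_basis G v) N (M v) p q"
      unfolding mat_mul_def using pq by (intro sum.cong) (auto simp: local_basis_def vertex_sum_def)
    finally show "mat_mul (local_basis G v) N (M v) p q = mat_id p q"
      using inv pq by (auto simp: is_mat_inv_def mat_eq_def local_basis_def)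
  qed
  then show ?thesis by (simp add: is_mat_inv_def mat_eq_def)
qed

lemma local_bc_combination:
  assumes "local_bc G A B C Av Bv"
  shows "mat_eq (basis_set G) (basis_set G)
    (mat_mul (basis_set G) C (\<lambda>p q. A p q + z * B p q))
    (vertex_sum G (\<lambda>v p q. Av v p q + z * Bv v p q))"
  unfolding mat_eq_def
proof (intro ballI)
  fix p q assume pq: "p \<in> basis_set G" "q \<in> basis_set G"
  have "mat_mul (basis_set G) C (\<lambda>p q. A p q + z * B p q) p q
    = mat_mul (basis_set G) C A p q + z * mat_mul (basis_set G) C B p q"
    by (simp add: mat_mul_def sum.distrib sum_distrib_left algebra_simps)
  also have "\<dots> = vertex_sum G Av p q + z * vertex_sum G Bv p q"
    using assms pq by (simp add: local_bc_def mat_eq_def)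
  also have "\<dots> = vertex_sum G (\<lambda>v p q. Av v p q + z * Bv v p q) p q"
    by (simp add: vertex_sum_def)
  finally show "mat_mul (basis_set G) C (\<lambda>p q. A p q + z * B p q) p q
    = vertex_sum G (\<lambda>v p q. Av v p q + z * Bv v p q) p q" .
qed

lemma is_mat_inv_mul:
  assumes "finite K" and "is_mat_inv K M M'" and "is_mat_inv K N N'"
  shows "is_mat_inv K (mat_mul K M N) (mat_mul K N' M')"
proof -
  have *: "mat_eq K K (mat_mul K (mat_mul K P Q) (mat_mul K Q' P')) mat_id"
    if "mat_eq K K (mat_mul K P P') mat_id" "mat_eq K K (mat_mul K Q Q') mat_id"
    for P Q P' Q' :: "('a, 'a) cmat"
  proof -
    have "mat_eq K K (mat_mul K P (mat_mul K (mat_mul K Q Q') P')) (mat_mul K P P')"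
      by (rule mat_eq_mul[OF mat_eq_refl
            mat_eq_trans[OF mat_eq_mul[OF that(2) mat_eq_refl] mat_mul_id_left[OF assms(1)]]])
    from mat_eq_trans[OF this that(1)] show ?thesis by (simp only: mat_mul_assoc)
  qed
  show ?thesis
    unfolding is_mat_inv_def
    by (intro conjI *) (use assms in \<open>simp_all add: is_mat_inv_def\<close>)
qed

lemma is_mat_inv_cong:
  assumes "mat_eq K K M M'" and "is_mat_inv K M N"
  shows "is_mat_inv K M' N"
  using assms by (simp add: is_mat_inv_def mat_eq_def mat_mul_def)

lemma mat_inverse: "is_mat_inv K M N \<Longrightarrow> is_mat_inv K M (mat_inverse K M)"
  unfolding mat_inverse_def by (rule someI[where P = "is_mat_inv K M"])

definition global_scattering_matrix where
  "global_scattering_matrix G k Av Bv = vertex_sum G (vertex_scattering_matrix G k Av Bv)"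

text \<open>Multiplied by \<open>C\<close>, the matrix \<open>A + ikB\<close> becomes block diagonal
  and stays invertible. So every vertex block is invertible, \<open>mat_inverse\<close> yields a
  genuine inverse, and the equation holds block by block. The inverse \<open>D\<close> of
  \<open>C\<close> then removes \<open>C\<close> again.\<close>

lemma global_scattering_matrix_eq:
  fixes k :: real
  assumes fin: "finite (basis_set G)" and bc: "local_bc G A B C Av Bv"
    and N: "is_mat_inv (basis_set G) (\<lambda>p q. A p q + \<i> * complex_of_real k * B p q) N"
  shows "mat_eq (basis_set G) (basis_set G)
    (mat_mul (basis_set G) (\<lambda>p q. A p q + \<i> * complex_of_real k * B p q)
       (global_scattering_matrix G k Av Bv))
    (\<lambda>p q. - (A p q - \<i> * complex_of_real k * B p q))"
proof -
  let ?K = "basis_set G" and ?S = "global_scattering_matrix G k Av Bv"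
  let ?M = "\<lambda>p q. A p q + \<i> * complex_of_real k * B p q"
  let ?M' = "\<lambda>p q. A p q - \<i> * complex_of_real k * B p q"
  let ?Mv = "\<lambda>v p q. Av v p q + \<i> * complex_of_real k * Bv v p q"
  let ?Mv' = "\<lambda>v p q. Av v p q - \<i> * complex_of_real k * Bv v p q"
  obtain D where D: "is_mat_inv ?K C D"
    using bc by (auto simp: local_bc_def mat_invertible_def)
  have M: "mat_eq ?K ?K (mat_mul ?K C ?M) (vertex_sum G ?Mv)"
    by (rule local_bc_combination[OF bc])
  have M': "mat_eq ?K ?K (mat_mul ?K C (\<lambda>p q. - ?M' p q)) (\<lambda>p q. - vertex_sum G ?Mv' p q)"
  proof -
    have "mat_mul ?K C (\<lambda>p q. - ?M' p q) p q = - mat_mul ?K C ?M' p q" for p q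
      by (simp only: mat_mul_def mult_minus_right sum_negf)
    moreover have "mat_eq ?K ?K (mat_mul ?K C ?M') (vertex_sum G ?Mv')"
      using local_bc_combination[OF bc, of "- \<i> * complex_of_real k"] by simp
    ultimately show ?thesis by (simp only: mat_eq_def) simp
  qed
  have "is_mat_inv ?K (vertex_sum G ?Mv) (mat_mul ?K N D)"
    by (rule is_mat_inv_cong[OF M is_mat_inv_mul[OF fin D N]])
  note inv = vertex_sum_inverse_block[OF fin this]
  have block: "mat_mul (local_basis G v) (?Mv v) (vertex_scattering_matrix G k Av Bv v) p q
    = - ?Mv' v p q" if "p \<in> local_basis G v" "q \<in> local_basis G v" for v p q
  proof -
    let ?L = "local_basis G v"
    have finL: "finite ?L" using fin by (simp add: local_basis_def)
    have "is_mat_inv ?L (?Mv v) (mat_inverse ?L (?Mv v))"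
      using inv by (rule mat_inverse)
    then have 1: "mat_eq ?L ?L (mat_mul ?L (?Mv v) (mat_inverse ?L (?Mv v))) mat_id"
      by (simp add: is_mat_inv_def)
    have "mat_mul ?L (?Mv v) (vertex_scattering_matrix G k Av Bv v) p q
      = - mat_mul ?L (?Mv v) (mat_mul ?L (mat_inverse ?L (?Mv v)) (?Mv' v)) p q"
      by (simp only: mat_mul_def[of ?L "?Mv v"] vertex_scattering_matrix_def mult_minus_right
          sum_negf)
    also have "\<dots> = - mat_mul ?L (mat_mul ?L (?Mv v) (mat_inverse ?L (?Mv v))) (?Mv' v) p q"
      by (simp only: mat_mul_assoc)
    also have "\<dots> = - ?Mv' v p q"
      by (rule mat_eq_trans[OF mat_eq_mul[OF 1 mat_eq_refl] mat_mul_id_left[OF finL],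
            unfolded mat_eq_def, rule_format, OF that, THEN arg_cong])
    finally show ?thesis .
  qed
  have "mat_eq ?K ?K (mat_mul ?K (vertex_sum G ?Mv) ?S) (\<lambda>p q. - vertex_sum G ?Mv' p q)"
    unfolding mat_eq_def
  proof (intro ballI)
    fix p q assume pq: "p \<in> ?K" "q \<in> ?K"
    show "mat_mul ?K (vertex_sum G ?Mv) ?S p q = - vertex_sum G ?Mv' p q"
      unfolding global_scattering_matrix_def vertex_sum_mul[OF fin pq]
      using block[of p "basis_vertex G p" q] pq by (auto simp: vertex_sum_def local_basis_def)
  qed
  then have "mat_eq ?K ?K (mat_mul ?K (mat_mul ?K C ?M) ?S) (mat_mul ?K C (\<lambda>p q. - ?M' p q))"
    by (rule mat_eq_trans[OF mat_eq_mul[OF M mat_eq_refl] mat_eq_trans[OF _ mat_eq_sym[OF M']]])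
  then have *: "mat_eq ?K ?K (mat_mul ?K D (mat_mul ?K C (mat_mul ?K ?M ?S)))
      (mat_mul ?K D (mat_mul ?K C (\<lambda>p q. - ?M' p q)))"
    unfolding mat_mul_assoc by (rule mat_eq_mul[OF mat_eq_refl])
  have DC: "mat_eq ?K ?K (mat_mul ?K D (mat_mul ?K C P)) P" for P
    unfolding mat_mul_assoc[symmetric]
    by (rule mat_eq_trans[OF mat_eq_mul[OF _ mat_eq_refl] mat_mul_id_left[OF fin]])
      (use D in \<open>simp add: is_mat_inv_def\<close>)
  show ?thesis
    by (rule mat_eq_trans[OF mat_eq_sym[OF DC] mat_eq_trans[OF * DC]])
qed

text \<open>Write \<open>M = A + ikB\<close> and \<open>M' = -(A - ikB)\<close>, so that
  \<open>S = N M'\<close>. The Gram matrices of \<open>M\<close> and \<open>M'\<close> agree, hence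
  the Gram matrix of \<open>S\<close> is that of \<open>N M\<close>, which is the identity.\<close>

lemma global_scattering_matrix_unitary:
  fixes k :: real
  assumes fin: "finite (basis_set G)" and bc: "local_bc G A B C Av Bv"
    and N: "is_mat_inv (basis_set G) (\<lambda>p q. A p q + \<i> * complex_of_real k * B p q) N"
    and sa: "self_adjoint (basis_set G) (mat_mul (basis_set G) A (mat_adj B))"
  shows "is_mat_inv (basis_set G) (global_scattering_matrix G k Av Bv)
    (mat_adj (global_scattering_matrix G k Av Bv))"
proof -
  let ?K = "basis_set G" and ?S = "global_scattering_matrix G k Av Bv"
  let ?M = "\<lambda>p q. A p q + \<i> * complex_of_real k * B p q"
  let ?M' = "\<lambda>p q. - (A p q - \<i> * complex_of_real k * B p q)"
  have NM: "mat_eq ?K ?K (mat_mul ?K N ?M) mat_id"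
    using N by (simp add: is_mat_inv_def)
  have MS: "mat_eq ?K ?K (mat_mul ?K ?M ?S) ?M'"
    by (rule global_scattering_matrix_eq[OF fin bc N])
  \<comment> \<open>The two signs cancel, which leaves the Gram matrix for \<open>- k\<close>. By
    \<open>self_adjoint_gram\<close> it depends only on the square of \<open>k\<close>.\<close>
  have "mat_mul ?K ?M' (mat_adj ?M')
    = mat_mul ?K (\<lambda>p q. A p q + \<i> * complex_of_real (- k) * B p q)
       (mat_adj (\<lambda>p q. A p q + \<i> * complex_of_real (- k) * B p q))"
    by (intro ext) (simp add: mat_mul_def mat_adj_def algebra_simps)
  then have gram: "mat_eq ?K ?K (mat_mul ?K ?M' (mat_adj ?M')) (mat_mul ?K ?M (mat_adj ?M))"
    using self_adjoint_gram[OF sa, of "- k"] self_adjoint_gram[OF sa, of k]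
    by (simp only: mat_eq_def of_real_minus power2_minus) simp
  have S: "mat_eq ?K ?K ?S (mat_mul ?K N ?M')"
  proof -
    have "mat_eq ?K ?K (mat_mul ?K (mat_mul ?K N ?M) ?S) ?S"
      by (rule mat_eq_trans[OF mat_eq_mul[OF NM mat_eq_refl] mat_mul_id_left[OF fin]])
    moreover have "mat_eq ?K ?K (mat_mul ?K (mat_mul ?K N ?M) ?S) (mat_mul ?K N ?M')"
      unfolding mat_mul_assoc by (rule mat_eq_mul[OF mat_eq_refl MS])
    ultimately show ?thesis by (blast intro: mat_eq_trans[OF mat_eq_sym])
  qed
  have 1: "mat_eq ?K ?K (mat_mul ?K ?S (mat_adj ?S))
    (mat_mul ?K (mat_mul ?K N ?M') (mat_adj (mat_mul ?K N ?M')))"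
    by (rule mat_eq_mul[OF S mat_eq_adj[OF S]])
  have 2: "mat_eq ?K ?K (mat_mul ?K (mat_mul ?K N ?M') (mat_adj (mat_mul ?K N ?M')))
    (mat_mul ?K (mat_mul ?K N ?M) (mat_adj (mat_mul ?K N ?M)))"
    using mat_eq_mul[OF mat_eq_refl mat_eq_mul[OF gram mat_eq_refl]]
    by (simp only: mat_adj_mul mat_mul_assoc)
  have 3: "mat_eq ?K ?K (mat_mul ?K (mat_mul ?K N ?M) (mat_adj (mat_mul ?K N ?M))) mat_id"
    using mat_eq_trans[OF mat_eq_mul[OF NM mat_eq_adj[OF NM]] mat_mul_id_left[OF fin]]
    by (simp only: mat_adj_id)
  have "mat_eq ?K ?K (mat_mul ?K ?S (mat_adj ?S)) mat_id"
    by (rule mat_eq_trans[OF 1 mat_eq_trans[OF 2 3]])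
  then show ?thesis
    using right_inverse_imp_left_inverse[OF fin] by (simp add: is_mat_inv_def)
qed

section \<open>Amplitudes and the energy balance\<close>

definition mat_vec :: "'c set \<Rightarrow> ('r, 'c) cmat \<Rightarrow> ('c \<Rightarrow> complex) \<Rightarrow> 'r \<Rightarrow> complex" where
  "mat_vec K M x p = (\<Sum>q\<in>K. M p q * x q)"

definition energy :: "'r set \<Rightarrow> ('r \<Rightarrow> complex) \<Rightarrow> real" where
  "energy K x = (\<Sum>p\<in>K. (cmod (x p))\<^sup>2)"

lemma energy_nonneg: "energy K x \<ge> 0"
  by (simp add: energy_def sum_nonneg)

lemma energy_cong: "(\<And>p. p \<in> K \<Longrightarrow> x p = y p) \<Longrightarrow> energy K x = energy K y"
  by (simp add: energy_def)

lemma of_real_energy: "complex_of_real (energy K x) = (\<Sum>p\<in>K. x p * cnj (x p))"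
  by (simp only: energy_def of_real_sum complex_norm_square)

lemma norm_le_energy: "finite K \<Longrightarrow> p \<in> K \<Longrightarrow> (cmod (x p))\<^sup>2 \<le> energy K x"
  unfolding energy_def by (rule member_le_sum) auto

lemma sqrt_energy_triangle:
  "sqrt (energy K (\<lambda>p. x p + y p)) \<le> sqrt (energy K x) + sqrt (energy K y)"
proof -
  have "sqrt (energy K (\<lambda>p. x p + y p)) \<le> L2_set (\<lambda>p. cmod (x p) + cmod (y p)) K"
    unfolding energy_def L2_set_def
    by (intro real_sqrt_le_mono sum_mono power_mono norm_triangle_ineq) auto
  also have "\<dots> \<le> L2_set (\<lambda>p. cmod (x p)) K + L2_set (\<lambda>p. cmod (y p)) K"
    by (rule L2_set_triangle_ineq)
  finally show ?thesis by (simp add: energy_def L2_set_def)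
qed

lemma sqrt_energy_scale: "sqrt (energy K (\<lambda>p. z * x p)) = cmod z * sqrt (energy K x)"
  by (simp add: energy_def norm_mult power_mult_distrib sum_distrib_left[symmetric] real_sqrt_mult)

lemma energy_isometry:
  assumes "finite K" and "mat_eq K K (mat_mul J M (mat_adj M)) mat_id"
  shows "energy J (\<lambda>q. \<Sum>p\<in>K. y p * M p q) = energy K y"
proof -
  have "complex_of_real (energy J (\<lambda>q. \<Sum>p\<in>K. y p * M p q))
    = (\<Sum>p\<in>K. \<Sum>r\<in>K. y p * cnj (y r) * mat_mul J M (mat_adj M) p r)"
    unfolding of_real_energy by (rule gram_form[symmetric])
  also have "\<dots> = (\<Sum>p\<in>K. \<Sum>r\<in>K. if p = r then y p * cnj (y r) else 0)"
    using assms(2) by (intro sum.cong refl) (simp add: mat_eq_def mat_id_def)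
  also have "\<dots> = complex_of_real (energy K y)"
    using assms(1) by (simp add: of_real_energy)
  finally show ?thesis by (simp only: of_real_eq_iff)
qed

text \<open>This is the map \<tau> of the idea above. What leaves one end of an internal line
  arrives at its other end with a phase; what leaves along an external line never comes back, hence
  the 0.\<close>

fun transfer :: "real \<Rightarrow> ('i \<Rightarrow> real) \<Rightarrow> (('i, 'e) basis \<Rightarrow> complex) \<Rightarrow> ('i, 'e) basis \<Rightarrow> complex"
  where
    "transfer k a x (KE e) = 0"
  | "transfer k a x (KIm i) = cis (k * a i) * x (KIp i)"
  | "transfer k a x (KIp i) = cis (k * a i) * x (KIm i)"

text \<open>The analytic part of the argument works with an abstract unitary \<open>S\<close>. The
  link to the boundary conditions and the block structure of \<open>S\<close> are assumed in the
  later contexts that use them.\<close>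

locale scattering_network =
  fixes G :: "('v, 'i, 'e) line_graph" and S :: "(('i, 'e) basis, ('i, 'e) basis) cmat"
  assumes finite_lines: "finite (arcs (internal G))" "finite (external G)"
    and unitary: "is_mat_inv (basis_set G) S (mat_adj S)"
begin

abbreviation "K \<equiv> basis_set G"
abbreviation "I \<equiv> arcs (internal G)"

lemma finite_K: "finite K"
  using finite_lines by (simp add: basis_set_def)

lemma sum_K: "sum f K = (\<Sum>e\<in>external G. f (KE e)) + (\<Sum>i\<in>I. f (KIm i) + f (KIp i))"
  for f :: "('i, 'e) basis \<Rightarrow> 'a :: comm_monoid_add"
proof -
  have "sum f K = sum f (KE ` external G) + sum f (KIm ` I) + sum f (KIp ` I)"
    unfolding basis_set_def using finite_lines
    by (subst sum.union_disjoint, (auto)[3], subst sum.union_disjoint) auto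
  then show ?thesis
    by (simp add: sum.reindex inj_on_def sum.distrib add.assoc)
qed

lemma KE_in_K [simp]: "KE e \<in> K \<longleftrightarrow> e \<in> external G"
  and KIm_in_K [simp]: "KIm i \<in> K \<longleftrightarrow> i \<in> I"
  and KIp_in_K [simp]: "KIp i \<in> K \<longleftrightarrow> i \<in> I"
  by (auto simp: basis_set_def)

text \<open>The isometry lemma is about row vectors, so it is applied to the transpose of
  \<open>S\<close>. The condition then becomes that \<open>mat_adj S\<close> is a left
  inverse.\<close>

lemma energy_mat_vec: "energy K (mat_vec K S x) = energy K x"
proof -
  have "mat_mul K (\<lambda>p q. S q p) (mat_adj (\<lambda>p q. S q p)) p r = mat_mul K (mat_adj S) S r p" for p r
    by (simp add: mat_mul_def mat_adj_def mult.commute)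
  then have "mat_eq K K (mat_mul K (\<lambda>p q. S q p) (mat_adj (\<lambda>p q. S q p))) mat_id"
    using unitary by (auto simp: is_mat_inv_def mat_eq_def mat_id_def)
  from energy_isometry[OF finite_K this, of x]
  moreover have "(\<lambda>q. \<Sum>p\<in>K. x p * S q p) = mat_vec K S x"
    by (simp add: mat_vec_def mult.commute fun_eq_iff)
  ultimately show ?thesis by (simp only:)
qed

lemma energy_mat_vec_left: "energy K (\<lambda>q. \<Sum>p\<in>K. y p * S p q) = energy K y"
  using unitary by (intro energy_isometry finite_K) (simp add: is_mat_inv_def)

definition ext_energy :: "(('i, 'e) basis \<Rightarrow> complex) \<Rightarrow> real" where
  "ext_energy x = (\<Sum>e\<in>external G. (cmod (x (KE e)))\<^sup>2)"

lemma norm_le_ext_energy: "e \<in> external G \<Longrightarrow> (cmod (x (KE e)))\<^sup>2 \<le> ext_energy x"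
  unfolding ext_energy_def using finite_lines by (intro member_le_sum) auto

lemma ext_energy_nonneg: "ext_energy x \<ge> 0"
  by (simp add: ext_energy_def sum_nonneg)

lemma energy_transfer: "energy K (transfer k a x) = energy K x - ext_energy x"
  by (simp add: energy_def ext_energy_def sum_K norm_mult add.commute)

text \<open>The source sits on the external component of \<open>e'\<close>, where
  \<open>transfer\<close> vanishes. The two summands have disjoint supports, so their energies
  add.\<close>

lemma energy_source_transfer:
  assumes "e' \<in> external G"
  shows "energy K (\<lambda>p. mat_id p (KE e') + complex_of_real r * transfer k a x p)
    = 1 + r\<^sup>2 * (energy K x - ext_energy x)"
proof -
  have "(\<Sum>e\<in>external G. (cmod (mat_id (KE e) (KE e' :: ('i, 'e) basis)))\<^sup>2)
    = (\<Sum>e\<in>external G. if e = e' then 1 else 0)"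
    by (intro sum.cong) (auto simp: mat_id_def)
  also have "\<dots> = 1" using assms finite_lines by simp
  finally show ?thesis
    by (simp add: energy_def ext_energy_def sum_K norm_mult mat_id_def[of "KIm _"]
        mat_id_def[of "KIp _"] power_mult_distrib sum_distrib_left algebra_simps)
qed

section \<open>Existence and stability of solutions of the fixed point equation\<close>

lemma transfer_eq_sum:
  assumes "q \<in> K"
  shows "transfer k a x q = (\<Sum>j\<in>K. transfer k a (\<lambda>p. mat_id p j) q * x j)"
  using assms finite_K
  by (cases q) (simp_all add: mat_id_def if_distrib[of "\<lambda>x. _ * x"] if_distrib[of "\<lambda>x. x * _"]
      cong: if_cong)

lemma transfer_symmetric: "transfer k a (\<lambda>p. mat_id p j) q = transfer k a (\<lambda>p. mat_id p q) j"
  by (cases q; cases j) (auto simp: mat_id_def)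

text \<open>For \<open>r = 1\<close> this is the scattering equation as a fixed point equation for
  the column of \<open>e'\<close>; a smaller \<open>r\<close> damps every passage along an internal
  line. It constrains \<open>u\<close> only on the basis.\<close>

definition amplitude :: "real \<Rightarrow> ('i \<Rightarrow> real) \<Rightarrow> 'e \<Rightarrow> real \<Rightarrow> (('i, 'e) basis \<Rightarrow> complex) \<Rightarrow> bool"
  where "amplitude k a e' r u \<longleftrightarrow> (\<forall>p\<in>K. u p =
    mat_vec K S (\<lambda>q. mat_id q (KE e') + complex_of_real r * transfer k a u q) p)"

text \<open>The equation may be singular, so the Fredholm alternative is used. For \<open>y\<close>
  in the left kernel put \<open>z = y S\<close>; then \<open>y\<close> is the transfer of
  \<open>z\<close>. As \<open>S\<close> preserves energy, \<open>z\<close> has no external energy,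
  so \<open>z (KE e') = 0\<close>, which says that \<open>y\<close> also kills the right-hand
  side.\<close>

lemma amplitude_exists:
  assumes e': "e' \<in> external G"
  shows "\<exists>u. amplitude k a e' 1 u"
proof -
  let ?t = "\<lambda>q j. transfer k a (\<lambda>p. mat_id p j) q"
  \<comment> \<open>\<open>Q j\<close> is column \<open>j\<close> of the identity minus
    \<open>S\<close> times the matrix of \<open>transfer\<close>.\<close>
  define Q where "Q j p = mat_id p j - (\<Sum>q\<in>K. S p q * ?t q j)" for j p
  have "\<not> (\<exists>y. (\<forall>j\<in>K. (\<Sum>r\<in>K. y r * Q j r) = 0) \<and> (\<Sum>r\<in>K. y r * S r (KE e')) \<noteq> 0)"
  proof
    assume "\<exists>y. (\<forall>j\<in>K. (\<Sum>r\<in>K. y r * Q j r) = 0) \<and> (\<Sum>r\<in>K. y r * S r (KE e')) \<noteq> 0"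
    then obtain y where y: "\<And>j. j \<in> K \<Longrightarrow> (\<Sum>r\<in>K. y r * Q j r) = 0"
      and nz: "(\<Sum>r\<in>K. y r * S r (KE e')) \<noteq> 0" by blast
    define z where "z q = (\<Sum>p\<in>K. y p * S p q)" for q
    have yz: "y j = transfer k a z j" if "j \<in> K" for j
    proof -
      have "(\<Sum>r\<in>K. y r * Q j r) = (\<Sum>r\<in>K. y r * mat_id r j) - (\<Sum>r\<in>K. \<Sum>q\<in>K. y r * S r q * ?t q j)"
        by (simp add: Q_def right_diff_distrib sum_subtractf sum_distrib_left mult.assoc)
      also have "(\<Sum>r\<in>K. \<Sum>q\<in>K. y r * S r q * ?t q j) = (\<Sum>q\<in>K. ?t j q * z q)"
        by (subst sum.swap)
          (simp add: z_def sum_distrib_left mult.commute transfer_symmetric[of k a j])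
      also have "\<dots> = transfer k a z j" by (rule transfer_eq_sum[OF that, symmetric])
      also have "(\<Sum>r\<in>K. y r * mat_id r j) = y j"
        using that finite_K by (simp add: mat_id_def if_distrib[of "\<lambda>x. _ * x"] cong: if_cong)
      finally show ?thesis using y[OF that] by simp
    qed
    have "energy K z = energy K y"
      unfolding z_def by (rule energy_mat_vec_left)
    also have "\<dots> = energy K z - ext_energy z"
      using yz energy_transfer[of k a z] by (simp cong: energy_cong)
    finally have "ext_energy z = 0" by simp
    then have "z (KE e') = 0"
      using norm_le_ext_energy[OF e', of z] by simp
    then show False using nz by (simp add: z_def)
  qed
  then obtain u where u: "\<forall>p\<in>K. (\<Sum>j\<in>K. u j * Q j p) = S p (KE e')"
    using fredholm_alternative[OF finite_K finite_K, of Q "\<lambda>p. S p (KE e')"] by blast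
  have "amplitude k a e' 1 u"
    unfolding amplitude_def
  proof
    fix p assume p: "p \<in> K"
    have "S p (KE e') = (\<Sum>j\<in>K. u j * mat_id p j) - (\<Sum>j\<in>K. \<Sum>q\<in>K. S p q * (?t q j * u j))"
      using u p by (simp add: Q_def right_diff_distrib sum_subtractf sum_distrib_left mult_ac)
    also have "(\<Sum>j\<in>K. u j * mat_id p j) = u p"
      using p finite_K by (simp add: mat_id_def if_distrib[of "\<lambda>x. _ * x"] cong: if_cong)
    also have "(\<Sum>j\<in>K. \<Sum>q\<in>K. S p q * (?t q j * u j)) = (\<Sum>q\<in>K. S p q * transfer k a u q)"
      by (subst sum.swap) (simp add: sum_distrib_left[symmetric] transfer_eq_sum[symmetric])
    finally have "u p = S p (KE e') + (\<Sum>q\<in>K. S p q * transfer k a u q)" by simp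
    also have "S p (KE e') = (\<Sum>q\<in>K. S p q * mat_id q (KE e'))"
      using e' finite_K by (simp add: mat_id_def if_distrib[of "\<lambda>x. _ * x"] cong: if_cong)
    finally show "u p = mat_vec K S (\<lambda>q. mat_id q (KE e') + complex_of_real 1 * transfer k a u q) p"
      by (simp add: mat_vec_def sum.distrib algebra_simps)
  qed
  then show ?thesis by blast
qed

text \<open>The energy balance reads \<open>r^2 * ext_energy u = 1 - (1 - r^2) * energy K u\<close>,
  and the subtracted term is nonnegative. The total energy of \<open>u\<close> need not be
  controlled.\<close>

lemma amplitude_bound:
  assumes e: "e \<in> external G" and e': "e' \<in> external G" and u: "amplitude k a e' r u"
    and r: "0 < r" "r \<le> 1"
  shows "cmod (u (KE e)) \<le> 1 / r"
proof -
  have "energy K u = energy K (\<lambda>q. mat_id q (KE e') + complex_of_real r * transfer k a u q)"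
    using u energy_mat_vec by (simp add: amplitude_def cong: energy_cong)
  also have "\<dots> = 1 + r\<^sup>2 * (energy K u - ext_energy u)"
    by (rule energy_source_transfer[OF e'])
  finally have "r\<^sup>2 * ext_energy u = 1 - (1 - r\<^sup>2) * energy K u"
    by (simp add: algebra_simps)
  moreover have "(1 - r\<^sup>2) * energy K u \<ge> 0"
    using r by (intro mult_nonneg_nonneg energy_nonneg) (simp add: power_le_one)
  moreover have "r\<^sup>2 * (cmod (u (KE e)))\<^sup>2 \<le> r\<^sup>2 * ext_energy u"
    by (intro mult_left_mono norm_le_ext_energy e) auto
  ultimately have "(r * cmod (u (KE e)))\<^sup>2 \<le> 1\<^sup>2" by (simp add: power_mult_distrib)
  then have "r * cmod (u (KE e)) \<le> 1" by (rule power2_le_imp_le) simp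
  then show ?thesis using r by (simp add: field_simps)
qed

text \<open>The difference \<open>d = u - w\<close> satisfies \<open>d = S (transfer y)\<close> with
  \<open>y = r d + (1 - r) u\<close>, so the external energy of \<open>y\<close> equals
  \<open>energy K y - energy K d\<close>. The triangle inequality bounds this by a multiple of
  \<open>1 - r\<close>, and the external part of \<open>y\<close> controls that of \<open>d\<close>.
  The bound involves only \<open>u\<close> and \<open>r\<close>, not an inverse of the possibly
  singular system.\<close>

lemma amplitude_diff_bound:
  assumes e: "e \<in> external G" and u: "amplitude k a e' 1 u" and w: "amplitude k a e' r w"
    and r: "0 < r" "r \<le> 1"
  shows "r * cmod (u (KE e) - w (KE e))
    \<le> sqrt (3 * (1 - r)) * sqrt (energy K u) + (1 - r) * cmod (u (KE e))"
proof -
  define d where "d p = u p - w p" for p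
  define y where "y p = complex_of_real r * d p + complex_of_real (1 - r) * u p" for p
  define \<mu> where "\<mu> = sqrt (energy K u)"
  define \<delta> where "\<delta> = sqrt (energy K d)"
  have nonneg: "\<mu> \<ge> 0" "\<delta> \<ge> 0" by (simp_all add: \<mu>_def \<delta>_def energy_nonneg)
  have ty: "transfer k a y q = transfer k a u q - complex_of_real r * transfer k a w q" for q
    by (cases q) (simp_all add: y_def d_def algebra_simps)
  have "d p = mat_vec K S (transfer k a y) p" if "p \<in> K" for p
    using u w that
    by (simp add: amplitude_def d_def mat_vec_def ty sum_subtractf[symmetric] algebra_simps)
  then have "energy K d = energy K (transfer k a y)"
    using energy_mat_vec by (simp cong: energy_cong)
  then have ed: "energy K d = energy K y - ext_energy y" by (simp add: energy_transfer)
  have y_le: "sqrt (energy K y) \<le> r * \<delta> + (1 - r) * \<mu>"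
    using sqrt_energy_triangle[of K "\<lambda>p. complex_of_real r * d p" "\<lambda>p. complex_of_real (1 - r) * u p"] r
    unfolding sqrt_energy_scale by (simp add: y_def[abs_def] \<delta>_def \<mu>_def del: of_real_diff)
  have "\<delta> \<le> sqrt (energy K y)"
    using ed ext_energy_nonneg by (simp add: \<delta>_def)
  with y_le have "(1 - r) * \<delta> \<le> (1 - r) * \<mu>" by (simp add: algebra_simps)
  then have dm: "\<delta> \<le> \<mu>" if "r < 1" using that by simp
  have "(cmod (y (KE e)))\<^sup>2 \<le> energy K y - energy K d"
    using norm_le_ext_energy[OF e, of y] ed by simp
  also have "\<dots> \<le> (r * \<delta> + (1 - r) * \<mu>)\<^sup>2 - \<delta>\<^sup>2"
    using power_mono[OF y_le, of 2] by (simp add: energy_nonneg \<delta>_def)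
  also have "\<dots> \<le> 3 * (1 - r) * \<mu>\<^sup>2"
  \<comment> \<open>The comparison of \<delta> with \<mu> needs \<open>r < 1\<close>. For
    \<open>r = 1\<close> both sides of the estimate are 0.\<close>
  proof (cases "r = 1")
    case False
    with r dm have dm: "\<delta> \<le> \<mu>" by simp
    \<comment> \<open>With \<open>x = (1 - r) * (\<mu> - \<delta>)\<close> the left side is the
      square of \<open>\<delta> + x\<close> minus that of \<delta>, that is
      \<open>x * (2 * \<delta> + x)\<close>.\<close>
    have "(r * \<delta> + (1 - r) * \<mu>)\<^sup>2 - \<delta>\<^sup>2
      = (1 - r) * ((\<mu> - \<delta>) * (2 * \<delta> + (1 - r) * (\<mu> - \<delta>)))"
      by (simp add: power2_eq_square algebra_simps)
    also have "\<dots> \<le> (1 - r) * (\<mu> * (3 * \<mu>))"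
    proof (intro mult_left_mono mult_mono)
      have "(1 - r) * (\<mu> - \<delta>) \<le> 1 * \<mu>"
        using r dm nonneg by (intro mult_mono) auto
      then show "2 * \<delta> + (1 - r) * (\<mu> - \<delta>) \<le> 3 * \<mu>" using dm by simp
    qed (use r dm nonneg in auto)
    finally show ?thesis by (simp add: power2_eq_square algebra_simps)
  qed (use nonneg in simp)
  finally have "cmod (y (KE e)) \<le> sqrt (3 * (1 - r) * \<mu>\<^sup>2)"
    by (rule real_le_rsqrt)
  then have ye: "cmod (y (KE e)) \<le> sqrt (3 * (1 - r)) * \<mu>"
    using nonneg by (simp add: real_sqrt_mult)
  have "r * cmod (d (KE e)) = cmod (y (KE e) - complex_of_real (1 - r) * u (KE e))"
    using r by (simp add: y_def norm_mult)
  also have "\<dots> \<le> cmod (y (KE e)) + (1 - r) * cmod (u (KE e))"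
    using r norm_triangle_ineq4[of "y (KE e)" "complex_of_real (1 - r) * u (KE e)"]
    by (simp add: norm_mult del: of_real_diff)
  finally show ?thesis using ye by (simp add: d_def \<mu>_def)
qed

text \<open>Here \<open>u\<close> is any undamped solution. Hence all undamped solutions share the
  external part that arises as the limit of the damped ones.\<close>

lemma amplitude_tendsto:
  assumes e: "e \<in> external G" and u: "amplitude k a e' 1 u"
    and w: "\<And>j. amplitude k a e' (r j) (w j)"
    and r: "\<And>j. 0 < r j" "\<And>j. r j \<le> 1" "r \<longlonglongrightarrow> 1"
  shows "(\<lambda>j. w j (KE e)) \<longlonglongrightarrow> u (KE e)"
proof -
  have "(\<lambda>j. (sqrt (3 * (1 - r j)) * sqrt (energy K u) + (1 - r j) * cmod (u (KE e))) / r j)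
    \<longlonglongrightarrow> (sqrt (3 * (1 - 1)) * sqrt (energy K u) + (1 - 1) * cmod (u (KE e))) / 1"
    by (intro tendsto_intros r) auto
  then have lim: "(\<lambda>j. (sqrt (3 * (1 - r j)) * sqrt (energy K u) + (1 - r j) * cmod (u (KE e))) / r j)
    \<longlonglongrightarrow> 0" by simp
  have "(\<lambda>j. w j (KE e) - u (KE e)) \<longlonglongrightarrow> 0"
  proof (rule Lim_null_comparison[OF _ lim], intro always_eventually allI)
    fix j
    show "norm (w j (KE e) - u (KE e))
      \<le> (sqrt (3 * (1 - r j)) * sqrt (energy K u) + (1 - r j) * cmod (u (KE e))) / r j"
      using amplitude_diff_bound[OF e u w r(1,2)] r(1)[of j]
      by (simp add: field_simps norm_minus_commute)
  qed
  then show ?thesis by (simp add: LIM_zero_iff)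
qed

section \<open>The terms of the Neumann series, one for each number of internal lines passed\<close>

primrec iterate :: "real \<Rightarrow> ('i \<Rightarrow> real) \<Rightarrow> 'e \<Rightarrow> nat \<Rightarrow> ('i, 'e) basis \<Rightarrow> complex" where
  "iterate k a e' 0 = (\<lambda>p. S p (KE e'))"
| "iterate k a e' (Suc m) = mat_vec K S (transfer k a (iterate k a e' m))"

lemma mat_vec_source:
  "e' \<in> external G \<Longrightarrow> mat_vec K S (\<lambda>q. mat_id q (KE e')) = (\<lambda>p. S p (KE e'))"
  using finite_K
  by (auto simp: mat_vec_def mat_id_def fun_eq_iff if_distrib[of "\<lambda>x. _ * x"] cong: if_cong)

text \<open>The first term is \<open>S\<close> applied to a source of energy 1; after that
  \<open>S\<close> preserves energy and \<open>transfer\<close> can only lose it.\<close>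

lemma energy_iterate: "e' \<in> external G \<Longrightarrow> energy K (iterate k a e' m) \<le> 1"
proof (induction m)
  case 0
  have "energy K (iterate k a e' 0) = energy K (\<lambda>q. mat_id q (KE e'))"
    using energy_mat_vec[of "\<lambda>q. mat_id q (KE e')"] 0 by (simp add: mat_vec_source)
  also have "\<dots> = 1"
    using energy_source_transfer[OF 0, of 0] by simp
  finally show ?case by simp
next
  case (Suc m)
  then show ?case
    using ext_energy_nonneg[of "iterate k a e' m"]
    by (simp add: energy_mat_vec energy_transfer)
qed

lemma norm_iterate: "e' \<in> external G \<Longrightarrow> p \<in> K \<Longrightarrow> cmod (iterate k a e' m p) \<le> 1"
  using norm_le_energy[OF finite_K, of p "iterate k a e' m"] energy_iterate[of e' k a m]
  by (metis order.trans power2_le_imp_le one_power2 zero_le_one)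

lemma summable_iterate:
  assumes "e' \<in> external G" "p \<in> K" "0 \<le> r" "r < 1"
  shows "summable (\<lambda>m. complex_of_real (r ^ m) * iterate k a e' m p)"
proof (rule summable_comparison_test')
  show "summable (\<lambda>m. r ^ m)" using assms by (intro summable_geometric) auto
  show "norm (complex_of_real (r ^ m) * iterate k a e' m p) \<le> r ^ m" if "m \<ge> 0" for m
    using norm_iterate[OF assms(1,2), of k a m] assms
    by (simp add: norm_mult norm_power mult_left_le)
qed

text \<open>Applying \<open>r\<close>, \<open>transfer\<close> and \<open>S\<close> to the series
  shifts it by one index, and the missing term of index 0 is supplied by the source.\<close>

lemma amplitude_iterate:
  assumes e': "e' \<in> external G" and r: "0 \<le> r" "r < 1"
  shows "amplitude k a e' r (\<lambda>p. \<Sum>m. complex_of_real (r ^ m) * iterate k a e' m p)"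
  unfolding amplitude_def
proof
  let ?u = "\<lambda>p. \<Sum>m. complex_of_real (r ^ m) * iterate k a e' m p"
  fix p assume p: "p \<in> K"
  have sums: "(\<lambda>m. complex_of_real (r ^ m) * transfer k a (iterate k a e' m) q) sums transfer k a ?u q"
    if "q \<in> K" for q
  proof (cases q)
    case (KIm i)
    have "(\<lambda>m. complex_of_real (r ^ m) * iterate k a e' m (KIp i)) sums ?u (KIp i)"
      using that KIm by (intro summable_sums summable_iterate e' r) simp
    from sums_mult[OF this, of "cis (k * a i)"] KIm show ?thesis by (simp add: mult_ac)
  next
    case (KIp i)
    have "(\<lambda>m. complex_of_real (r ^ m) * iterate k a e' m (KIm i)) sums ?u (KIm i)"
      using that KIp by (intro summable_sums summable_iterate e' r) simp
    from sums_mult[OF this, of "cis (k * a i)"] KIp show ?thesis by (simp add: mult_ac)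
  qed simp
  have "(\<lambda>m. \<Sum>q\<in>K. complex_of_real r * (S p q * (complex_of_real (r ^ m) * transfer k a (iterate k a e' m) q)))
    sums (\<Sum>q\<in>K. complex_of_real r * (S p q * transfer k a ?u q))"
    by (intro sums_sum sums_mult sums)
  then have "(\<lambda>m. complex_of_real (r ^ Suc m) * iterate k a e' (Suc m) p)
    sums (\<Sum>q\<in>K. complex_of_real r * (S p q * transfer k a ?u q))"
    by (simp add: mat_vec_def sum_distrib_left mult_ac)
  then have "(\<lambda>m. complex_of_real (r ^ m) * iterate k a e' m p)
    sums ((\<Sum>q\<in>K. complex_of_real r * (S p q * transfer k a ?u q)) + S p (KE e'))"
    by (subst (asm) sums_Suc_iff) simp
  then have "?u p = S p (KE e') + (\<Sum>q\<in>K. complex_of_real r * (S p q * transfer k a ?u q))"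
    by (simp add: sums_iff)
  also have "\<dots> = mat_vec K S (\<lambda>q. mat_id q (KE e') + complex_of_real r * transfer k a ?u q) p"
    unfolding fun_cong[OF mat_vec_source[OF e'], symmetric]
    by (simp add: mat_vec_def sum.distrib distrib_left mult_ac)
  finally show "?u p = mat_vec K S (\<lambda>q. mat_id q (KE e') + complex_of_real r * transfer k a ?u q) p" .
qed

end

section \<open>Fourier coefficients of the damped series\<close>

lemma sum_list_eq_sum_count_list:
  fixes f :: "'a \<Rightarrow> real"
  assumes "set xs \<subseteq> X" and "finite X"
  shows "sum_list (map f xs) = (\<Sum>x\<in>X. real (count_list xs x) * f x)"
  using assms(1)
proof (induction xs)
  case (Cons y ys)
  have "(\<Sum>x\<in>X. real (count_list (y # ys) x) * f x)
    = (\<Sum>x\<in>X. (if x = y then f x else 0) + real (count_list ys x) * f x)"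
    by (intro sum.cong refl) (auto simp: algebra_simps)
  then show ?case using Cons \<open>finite X\<close> by (simp add: sum.distrib)
qed simp

text \<open>For nonzero \<open>m\<close> the exponential has the antiderivative
  \<open>exp (c * t) / c\<close>, which takes equal values at both ends because the interval is a
  whole number of periods.\<close>

lemma character_integral:
  fixes k :: real and m :: int
  assumes "k > 0"
  shows "integrable lborel (\<lambda>t. indicator {0..2 * pi / k} (t :: real) *\<^sub>R cis (k * (real_of_int m * t)))"
    and "(LINT t|lborel. indicator {0..2 * pi / k} (t :: real) *\<^sub>R cis (k * (real_of_int m * t)))
      = (if m = 0 then complex_of_real (2 * pi / k) else 0)"
proof -
  have cont: "continuous_on {0..2 * pi / k} (\<lambda>t. cis (k * (real_of_int m * t)))"
    by (intro continuous_intros)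
  show "integrable lborel (\<lambda>t. indicator {0..2 * pi / k} (t :: real) *\<^sub>R cis (k * (real_of_int m * t)))"
    using borel_integrable_compact[OF compact_Icc cont] by (simp add: indicator_scaleR_eq_if)
  show "(LINT t|lborel. indicator {0..2 * pi / k} (t :: real) *\<^sub>R cis (k * (real_of_int m * t)))
      = (if m = 0 then complex_of_real (2 * pi / k) else 0)"
  proof (cases "m = 0")
    case True
    then show ?thesis using assms by (simp add: scaleR_conv_of_real)
  next
    case False
    define c where "c = \<i> * complex_of_real (k * real_of_int m)"
    define F where "F z = exp (c * z) / c" for z
    have "c \<noteq> 0" using False assms by (simp add: c_def)
    have cis: "cis (k * (real_of_int m * t)) = exp (c * complex_of_real t)" for t
      by (simp add: c_def cis_conv_exp mult.assoc)
    have "(LINT t|lborel. indicator {0..2 * pi / k} (t :: real) *\<^sub>R cis (k * (real_of_int m * t)))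
      = F (complex_of_real (2 * pi / k)) - F (complex_of_real 0)"
    proof (rule integral_FTC_atLeastAtMost)
      fix t :: real
      have "(F has_field_derivative exp (c * complex_of_real t)) (at (complex_of_real t))"
        unfolding F_def[abs_def] using \<open>c \<noteq> 0\<close> by (auto intro!: derivative_eq_intros)
      then show "((\<lambda>t. F (complex_of_real t)) has_vector_derivative cis (k * (real_of_int m * t)))
          (at t within {0..2 * pi / k})"
        unfolding cis by (rule has_vector_derivative_real_field)
    qed (use assms cont in auto)
    moreover have "cis (k * (real_of_int m * (2 * pi / k))) = 1"
      using cis_multiple_2pi[of "real_of_int m"] assms by (simp add: mult_ac)
    ultimately show ?thesis
      by (simp only: F_def cis of_real_0 mult_zero_right exp_zero diff_self if_not_P[OF False])
  qed
qed

text \<open>The integrand is a product of functions of single coordinates, so Fubini reduces the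
  claim to one dimension.\<close>

lemma box_character_integral:
  fixes k :: real and m :: "'i \<Rightarrow> int"
  assumes "finite I" and "k > 0"
  defines "g \<equiv> \<lambda>a. indicator (\<Pi>\<^sub>E i\<in>I. {0..2 * pi / k}) a *\<^sub>R
    cis (k * (\<Sum>i\<in>I. real_of_int (m i) * a i))"
  shows "integrable (\<Pi>\<^sub>M i\<in>I. lborel) g"
    and "(LINT a|(\<Pi>\<^sub>M i\<in>I. lborel). g a)
      = (if \<forall>i\<in>I. m i = 0 then complex_of_real ((2 * pi / k) ^ card I) else 0)"
proof -
  interpret product_sigma_finite "\<lambda>_ :: 'i. lborel :: real measure" ..
  let ?f = "\<lambda>i t. indicator {0..2 * pi / k} t *\<^sub>R cis (k * (real_of_int (m i) * t))"
  \<comment> \<open>The factorization needs \<open>a\<close> in the space of the product measure: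
    membership in the box also demands that \<open>a\<close> be undefined outside \<open>I\<close>,
    which the factors cannot see.\<close>
  have eq: "g a = (\<Prod>i\<in>I. ?f i (a i))" if "a \<in> space (\<Pi>\<^sub>M i\<in>I. lborel)" for a
  proof -
    have "indicator (\<Pi>\<^sub>E i\<in>I. {0..2 * pi / k}) a = (\<Prod>i\<in>I. indicator {0..2 * pi / k} (a i) :: real)"
      using that \<open>finite I\<close> by (auto simp: indicator_def PiE_iff space_PiM prod_zero_iff)
    moreover have "cis (k * (\<Sum>i\<in>I. real_of_int (m i) * a i)) = (\<Prod>i\<in>I. cis (k * (real_of_int (m i) * a i)))"
      using \<open>finite I\<close> by (simp add: cis_conv_exp exp_sum[symmetric] sum_distrib_left)
    ultimately show ?thesis
      by (simp add: g_def scaleR_conv_of_real prod.distrib)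
  qed
  have "integrable (\<Pi>\<^sub>M i\<in>I. lborel) (\<lambda>a. \<Prod>i\<in>I. ?f i (a i))"
    by (intro product_integrable_prod \<open>finite I\<close> character_integral \<open>k > 0\<close>)
  then show "integrable (\<Pi>\<^sub>M i\<in>I. lborel) g"
    by (subst Bochner_Integration.integrable_cong[OF refl eq])
  have "(LINT a|(\<Pi>\<^sub>M i\<in>I. lborel). g a) = (LINT a|(\<Pi>\<^sub>M i\<in>I. lborel). (\<Prod>i\<in>I. ?f i (a i)))"
    by (rule Bochner_Integration.integral_cong[OF refl eq])
  also have "\<dots> = (\<Prod>i\<in>I. integral\<^sup>L lborel (?f i))"
    by (intro product_integral_prod \<open>finite I\<close> character_integral \<open>k > 0\<close>)
  also have "\<dots> = (\<Prod>i\<in>I. if m i = 0 then complex_of_real (2 * pi / k) else 0)"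
    by (intro prod.cong refl character_integral \<open>k > 0\<close>)
  also have "\<dots> = (if \<forall>i\<in>I. m i = 0 then complex_of_real ((2 * pi / k) ^ card I) else 0)"
    using \<open>finite I\<close> by (auto simp: prod_zero_iff)
  finally show "(LINT a|(\<Pi>\<^sub>M i\<in>I. lborel). g a)
      = (if \<forall>i\<in>I. m i = 0 then complex_of_real ((2 * pi / k) ^ card I) else 0)" .
qed

section \<open>Expansion of the Neumann terms over words of internal lines\<close>

context scattering_network
begin

text \<open>The internal lines are listed from the last one traversed to the first.\<close>

primrec word_amplitude :: "'e \<Rightarrow> 'i list \<Rightarrow> ('i, 'e) basis \<Rightarrow> complex" where
  "word_amplitude e' [] p = S p (KE e')"
| "word_amplitude e' (i # js) p =
    S p (KIm i) * word_amplitude e' js (KIp i) + S p (KIp i) * word_amplitude e' js (KIm i)"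

text \<open>One more application of \<open>transfer\<close> and \<open>S\<close> puts the line
  passed last in front of the word and adds its phase. The two ends of that line give the two terms
  of \<open>word_amplitude\<close>; external components contribute nothing.\<close>

lemma iterate_eq_sum_words:
  "iterate k a e' m p = (\<Sum>js | set js \<subseteq> I \<and> length js = m.
     cis (k * sum_list (map a js)) * word_amplitude e' js p)"
proof (induction m arbitrary: p)
  case 0
  have "{js. set js \<subseteq> I \<and> length js = 0} = {[]}" by auto
  then show ?case by simp
next
  case (Suc m)
  let ?L = "{js. set js \<subseteq> I \<and> length js = m}"
  have "iterate k a e' (Suc m) p
    = (\<Sum>i\<in>I. \<Sum>js\<in>?L. cis (k * sum_list (map a (i # js))) * word_amplitude e' (i # js) p)"
    by (simp add: mat_vec_def sum_K Suc.IH sum_distrib_left distrib_left sum.distrib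
        cis_mult[symmetric] mult_ac)
  also have "\<dots> = (\<Sum>(js, i)\<in>?L \<times> I. cis (k * sum_list (map a (i # js))) * word_amplitude e' (i # js) p)"
    by (subst sum.swap) (simp add: sum.cartesian_product)
  also have "\<dots> = (\<Sum>js\<in>(\<lambda>(js, i). i # js) ` (?L \<times> I).
      cis (k * sum_list (map a js)) * word_amplitude e' js p)"
    by (subst sum.reindex) (auto simp: inj_on_def case_prod_unfold)
  finally show ?case by (simp only: lists_length_Suc_eq)
qed

text \<open>These words need not come from walks; for local \<open>S\<close> the others turn out to
  have amplitude 0.\<close>

definition score_words :: "('i \<Rightarrow> int) \<Rightarrow> 'i list set" where
  "score_words n = {js. set js \<subseteq> I \<and> (\<forall>i\<in>I. int (count_list js i) = n i)}"

text \<open>The score fixes the length, so only one Neumann term meets a given Fourier mode. The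
  conversion \<open>nat\<close> loses nothing, since a word with score \<open>n\<close> makes
  \<open>n\<close> nonnegative on \<open>I\<close>.\<close>

lemma length_score_word: "js \<in> score_words n \<Longrightarrow> length js = nat (\<Sum>i\<in>I. n i)"
proof -
  assume js: "js \<in> score_words n"
  then have "int (length js) = int (\<Sum>i\<in>I. count_list js i)"
    using sum_count_set[of js I] finite_lines by (simp only: score_words_def mem_Collect_eq)
  then show ?thesis using js by (simp add: score_words_def)
qed

lemma finite_score_words: "finite (score_words n)"
proof (rule finite_subset)
  show "score_words n \<subseteq> {js. set js \<subseteq> I \<and> length js = nat (\<Sum>i\<in>I. n i)}"
    using length_score_word by (auto simp: score_words_def)
qed (rule finite_lists_length_eq[OF finite_lines(1)])

abbreviation box :: "real \<Rightarrow> ('i \<Rightarrow> real) set" where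
  "box k \<equiv> \<Pi>\<^sub>E i\<in>I. {0..2 * pi / k}"

abbreviation lborel_I :: "('i \<Rightarrow> real) measure" where
  "lborel_I \<equiv> \<Pi>\<^sub>M i\<in>I. lborel"

abbreviation phase :: "real \<Rightarrow> ('i \<Rightarrow> int) \<Rightarrow> ('i \<Rightarrow> real) \<Rightarrow> complex" where
  "phase k n a \<equiv> exp (- \<i> * complex_of_real (k * (\<Sum>i\<in>I. real_of_int (n i) * a i)))"

lemma norm_phase: "cmod (phase k n a) = 1"
  by (simp add: norm_exp_eq_Re)

text \<open>A word contributes a character whose frequency is its score minus \<open>n\<close>. Its
  integral over the box vanishes unless the score is \<open>n\<close>.\<close>

lemma iterate_fourier:
  fixes n :: "'i \<Rightarrow> int" and e' :: 'e and m :: nat and p :: "('i, 'e) basis"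
  assumes k: "k > 0"
  defines "f \<equiv> \<lambda>a. indicator (box k) a *\<^sub>R (iterate k a e' m p * phase k n a)"
  shows "integrable lborel_I f"
    and "integral\<^sup>L lborel_I f = complex_of_real ((2 * pi / k) ^ card I) *
      (\<Sum>js | js \<in> score_words n \<and> length js = m. word_amplitude e' js p)"
proof -
  let ?L = "{js. set js \<subseteq> I \<and> length js = m}"
  let ?g = "\<lambda>js a. indicator (box k) a *\<^sub>R
    cis (k * (\<Sum>i\<in>I. real_of_int (int (count_list js i) - n i) * a i))"
  have finL: "finite ?L" by (rule finite_lists_length_eq[OF finite_lines(1)])
  have f: "f = (\<lambda>a. \<Sum>js\<in>?L. word_amplitude e' js p * ?g js a)"
  proof
    fix a
    have "cis (k * sum_list (map a js)) * phase k n a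
      = cis (k * (\<Sum>i\<in>I. real_of_int (int (count_list js i) - n i) * a i))" if "js \<in> ?L" for js
    proof -
      have "sum_list (map a js) = (\<Sum>i\<in>I. count_list js i * a i)"
        using that finite_lines by (intro sum_list_eq_sum_count_list) auto
      moreover have "phase k n a = cis (- (k * (\<Sum>i\<in>I. real_of_int (n i) * a i)))"
        by (simp add: cis_conv_exp)
      ultimately show ?thesis
        by (simp add: cis_mult sum_subtractf algebra_simps)
    qed
    then show "f a = (\<Sum>js\<in>?L. word_amplitude e' js p * ?g js a)"
      unfolding f_def iterate_eq_sum_words scaleR_right_distrib sum_distrib_right scaleR_sum_right
      by (intro sum.cong refl) (simp add: mult_ac)
  qed
  note box_int = box_character_integral[OF finite_lines(1) k]
  show "integrable lborel_I f"
    unfolding f by (intro Bochner_Integration.integrable_sum integrable_mult_right box_int)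
  have "integral\<^sup>L lborel_I f = (\<Sum>js\<in>?L. word_amplitude e' js p * (LINT a|lborel_I. ?g js a))"
    unfolding f
    by (rule trans[OF Bochner_Integration.integral_sum])
      (intro integrable_mult_right box_int, simp only: integral_mult_right_zero)
  also have "\<dots> = (\<Sum>js\<in>?L. if js \<in> score_words n
      then complex_of_real ((2 * pi / k) ^ card I) * word_amplitude e' js p else 0)"
    by (intro sum.cong refl) (simp only: box_int(2), auto simp: score_words_def)
  also have "\<dots> = (\<Sum>js\<in>{js \<in> ?L. js \<in> score_words n}.
      complex_of_real ((2 * pi / k) ^ card I) * word_amplitude e' js p)"
    by (rule sum.inter_filter[OF finL, symmetric])
  also have "{js \<in> ?L. js \<in> score_words n} = {js. js \<in> score_words n \<and> length js = m}"
    by (auto simp: score_words_def)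
  finally show "integral\<^sup>L lborel_I f = complex_of_real ((2 * pi / k) ^ card I) *
      (\<Sum>js | js \<in> score_words n \<and> length js = m. word_amplitude e' js p)"
    by (simp add: sum_distrib_left)
qed

text \<open>Domination by the geometric series allows the integral to be taken term by term. All
  words of score \<open>n\<close> have the same length, so a single term survives and the damping
  leaves just one power of \<open>r\<close>.\<close>

lemma abel_fourier:
  fixes n :: "'i \<Rightarrow> int" and e' :: 'e and r :: real and p :: "('i, 'e) basis"
  assumes k: "k > 0" and e': "e' \<in> external G" and p: "p \<in> K" and r: "0 \<le> r" "r < 1"
  defines "f \<equiv> \<lambda>a. indicator (box k) a *\<^sub>R
    ((\<Sum>m. complex_of_real (r ^ m) * iterate k a e' m p) * phase k n a)"
  shows "integrable lborel_I f"
    and "integral\<^sup>L lborel_I f = complex_of_real (r ^ nat (\<Sum>i\<in>I. n i)) *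
      (complex_of_real ((2 * pi / k) ^ card I) * (\<Sum>js\<in>score_words n. word_amplitude e' js p))"
proof -
  let ?V = "(2 * pi / k) ^ card I"
  let ?h = "\<lambda>m a. indicator (box k) a *\<^sub>R (iterate k a e' m p * phase k n a)"
  let ?w = "\<lambda>m. \<Sum>js | js \<in> score_words n \<and> length js = m. word_amplitude e' js p"
  let ?N = "nat (\<Sum>i\<in>I. n i)"
  define g where "g m a = complex_of_real (r ^ m) * ?h m a" for m a
  have f: "f = (\<lambda>a. \<Sum>m. g m a)"
  proof
    fix a
    have "(\<lambda>m. complex_of_real (r ^ m) * iterate k a e' m p) sums
      (\<Sum>m. complex_of_real (r ^ m) * iterate k a e' m p)"
      by (intro summable_sums summable_iterate e' p r)
    from sums_mult2[OF this, of "indicator (box k) a *\<^sub>R phase k n a"]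
    show "f a = (\<Sum>m. g m a)" by (simp add: f_def g_def sums_iff mult_ac)
  qed
  have g_int: "integrable lborel_I (g m)" for m
    unfolding g_def by (intro integrable_mult_right iterate_fourier k)
  have g_norm: "norm (g m a) \<le> r ^ m * indicator (box k) a" for m a
    using norm_iterate[OF e' p, of k a m] r
    by (auto simp: g_def norm_mult norm_power norm_phase indicator_def intro!: mult_left_le)
  have geom: "summable (\<lambda>m. r ^ m)" using r by (intro summable_geometric) auto
  have ind_int: "integrable lborel_I (\<lambda>a. indicator (box k) a :: real)"
    and ind_V: "(LINT a|lborel_I. indicator (box k) a :: real) = ?V"
  proof -
    \<comment> \<open>The character of frequency 0 is the constant 1, so its integral is the volume
      of the box.\<close>
    have eq: "indicator (box k) a *\<^sub>R cis (k * (\<Sum>i\<in>I. real_of_int 0 * a i))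
      = complex_of_real (indicator (box k) a)" for a
      by (simp add: scaleR_conv_of_real)
    note b = box_character_integral[OF finite_lines(1) k, of "\<lambda>_. 0", unfolded eq]
    show "integrable lborel_I (\<lambda>a. indicator (box k) a :: real)"
      using b(1) by (simp only: complex_of_real_integrable_eq)
    show "(LINT a|lborel_I. indicator (box k) a :: real) = ?V"
      using b(2) by (simp only: integral_complex_of_real of_real_eq_iff simp_thms ball_triv if_True)
  qed
  have sum1: "AE a in lborel_I. summable (\<lambda>m. norm (g m a))"
  proof (intro always_eventually allI)
    fix a
    have "summable (\<lambda>m. r ^ m * indicator (box k) a :: real)" by (intro summable_mult2 geom)
    then show "summable (\<lambda>m. norm (g m a))"
      by (rule summable_comparison_test') (use g_norm in simp)
  qed
  have sum2: "summable (\<lambda>m. LINT a|lborel_I. norm (g m a))"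
  proof (rule summable_comparison_test')
    show "summable (\<lambda>m. r ^ m * ?V)" by (intro summable_mult2 geom)
    fix m :: nat
    have "(LINT a|lborel_I. norm (g m a)) \<le> (LINT a|lborel_I. r ^ m * indicator (box k) a)"
      by (intro integral_mono integrable_norm g_int integrable_mult_right ind_int g_norm)
    also have "\<dots> = r ^ m * ?V" by (simp only: integral_mult_right_zero ind_V)
    finally show "norm (LINT a|lborel_I. norm (g m a)) \<le> r ^ m * ?V"
      by simp
  qed
  show "integrable lborel_I f"
    unfolding f by (rule integrable_suminf[OF g_int sum1 sum2])
  have "integral\<^sup>L lborel_I f = (\<Sum>m. integral\<^sup>L lborel_I (g m))"
    unfolding f by (rule integral_suminf[OF g_int sum1 sum2])
  also have "\<dots> = (\<Sum>m. complex_of_real (r ^ m) * (complex_of_real ?V * ?w m))"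
    by (simp only: g_def[abs_def] integral_mult_right_zero iterate_fourier(2)[OF k])
  also have "\<dots> = (\<Sum>m\<in>{?N}. complex_of_real (r ^ m) * (complex_of_real ?V * ?w m))"
  proof (rule suminf_finite)
    fix m assume "m \<notin> {?N}"
    then have "{js. js \<in> score_words n \<and> length js = m} = {}"
      using length_score_word by auto
    then show "complex_of_real (r ^ m) * (complex_of_real ?V * ?w m) = 0"
      by (simp only: sum.empty mult_zero_right)
  qed simp
  also have "\<dots> = complex_of_real (r ^ ?N) * (complex_of_real ?V *
      (\<Sum>js\<in>score_words n. word_amplitude e' js p))"
  proof -
    have "{js. js \<in> score_words n \<and> length js = ?N} = score_words n"
      using length_score_word by auto
    then show ?thesis by (simp only: sum.insert sum.empty finite.emptyI empty_iff not_False_eq_True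
        add_0_right)
  qed
  finally show "integral\<^sup>L lborel_I f = complex_of_real (r ^ ?N) *
      (complex_of_real ?V * (\<Sum>js\<in>score_words n. word_amplitude e' js p))" .
qed

text \<open>Dominated convergence as the damping is removed. The external parts converge at every
  \<open>a\<close>, including those where the undamped equation is singular.\<close>

lemma amplitude_fourier:
  fixes n :: "'i \<Rightarrow> int" and u :: "('i \<Rightarrow> real) \<Rightarrow> ('i, 'e) basis \<Rightarrow> complex"
  assumes k: "k > 0" and e: "e \<in> external G" and e': "e' \<in> external G"
    and u: "\<And>a. amplitude k a e' 1 (u a)"
  shows "(LINT a:box k|completion lborel_I. u a (KE e) * phase k n a)
    = complex_of_real ((2 * pi / k) ^ card I) * (\<Sum>js\<in>score_words n. word_amplitude e' js (KE e))"
proof -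
  let ?V = "(2 * pi / k) ^ card I"
  let ?W = "complex_of_real ?V * (\<Sum>js\<in>score_words n. word_amplitude e' js (KE e))"
  \<comment> \<open>The offset 2 keeps \<open>r j\<close> at least 1/2, so \<open>1 / r j\<close> is
    bounded by 2 uniformly in \<open>j\<close>.\<close>
  define r where "r j = 1 - 1 / real (j + 2)" for j :: nat
  define w where "w j a p = (\<Sum>m. complex_of_real (r j ^ m) * iterate k a e' m p)" for j a p
  define f where "f a = indicator (box k) a *\<^sub>R (u a (KE e) * phase k n a)" for a
  define g where "g j a = indicator (box k) a *\<^sub>R (w j a (KE e) * phase k n a)" for j a
  have r: "1 / 2 \<le> r j" "r j < 1" for j by (simp_all add: r_def field_simps)
  then have r0: "0 < r j" "0 \<le> r j" "r j \<le> 1" for j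
    by (smt (verit) divide_pos_pos zero_less_numeral)+
  have r_lim: "r \<longlonglongrightarrow> 1"
    using tendsto_diff[OF tendsto_const[of 1] LIMSEQ_ignore_initial_segment[OF lim_1_over_n, of 2]]
    by (simp add: r_def[abs_def])
  have w: "amplitude k a e' (r j) (w j a)" for j a
    unfolding w_def by (rule amplitude_iterate[OF e' r0(2) r(2)])
  have g_int: "integrable lborel_I (g j)"
    and g_val: "integral\<^sup>L lborel_I (g j) = complex_of_real (r j ^ nat (\<Sum>i\<in>I. n i)) * ?W" for j
    using abel_fourier[OF k e' _ r0(2)[of j] r(2)[of j], where p = "KE e" and n = n] e
    unfolding g_def w_def by simp_all
  have lim: "(\<lambda>j. g j a) \<longlonglongrightarrow> f a" for a
    unfolding g_def f_def
    by (intro tendsto_intros amplitude_tendsto[OF e u w r0(1,3) r_lim])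
  \<comment> \<open>The solutions \<open>u a\<close> are chosen separately for each
    \<open>a\<close>; measurability comes from \<open>f\<close> being the pointwise limit of the
    \<open>g j\<close>.\<close>
  have f_meas: "f \<in> borel_measurable lborel_I"
    by (rule borel_measurable_LIMSEQ_metric[of g]) (use g_int lim in auto)
  have ind_int: "integrable lborel_I (\<lambda>a. 2 * indicator (box k) a :: real)"
  proof -
    have "integrable lborel_I (\<lambda>a. indicator (box k) a *\<^sub>R cis (k * (\<Sum>i\<in>I. real_of_int 0 * a i)))"
      by (rule box_character_integral[OF finite_lines(1) k, of "\<lambda>_. 0"])
    from integrable_norm[OF this] show ?thesis by (simp add: integrable_mult_right)
  qed
  have "(\<lambda>j. integral\<^sup>L lborel_I (g j)) \<longlonglongrightarrow> integral\<^sup>L lborel_I f"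
  proof (rule integral_dominated_convergence[OF f_meas _ ind_int])
    show "g j \<in> borel_measurable lborel_I" for j using g_int by auto
    show "AE a in lborel_I. (\<lambda>j. g j a) \<longlonglongrightarrow> f a" using lim by simp
    show "AE a in lborel_I. norm (g j a) \<le> 2 * indicator (box k) a" for j
    proof (intro always_eventually allI)
      fix a
      have "cmod (w j a (KE e)) \<le> 1 / r j"
        by (rule amplitude_bound[OF e e' w r0(1,3)])
      also have "\<dots> \<le> 2" using r(1)[of j] r0(1)[of j] by (simp add: field_simps)
      finally show "norm (g j a) \<le> 2 * indicator (box k) a"
        by (auto simp: g_def norm_mult norm_phase indicator_def)
    qed
  qed
  from LIMSEQ_unique[OF this] have "integral\<^sup>L lborel_I f = x"
    if "(\<lambda>j. integral\<^sup>L lborel_I (g j)) \<longlonglongrightarrow> x" for x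
    using that .
  moreover have "(\<lambda>j. integral\<^sup>L lborel_I (g j)) \<longlonglongrightarrow> complex_of_real (1 ^ nat (\<Sum>i\<in>I. n i)) * ?W"
    unfolding g_val by (intro tendsto_intros r_lim)
  ultimately have "integral\<^sup>L lborel_I f = complex_of_real (1 ^ nat (\<Sum>i\<in>I. n i)) * ?W"
    by blast
  then have "integral\<^sup>L lborel_I f = ?W" by (simp only: power_one of_real_1 mult_1_left)
  moreover have "(LINT a:box k|completion lborel_I. u a (KE e) * phase k n a)
    = integral\<^sup>L (completion lborel_I) f"
    by (simp only: set_lebesgue_integral_def f_def[abs_def])
  ultimately show ?thesis by (simp add: integral_completion[OF f_meas])
qed

end

section \<open>Scattering solutions and walks\<close>

lemma mat_vec_cong: "(\<And>q. q \<in> K \<Longrightarrow> x q = y q) \<Longrightarrow> mat_vec K M x = mat_vec K M y"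
  by (simp add: mat_vec_def fun_eq_iff)

lemma mat_vec_mul: "mat_vec K M (mat_vec J N x) p = mat_vec J (mat_mul K M N) x p"
proof -
  have "mat_vec K M (mat_vec J N x) p = (\<Sum>m\<in>K. \<Sum>q\<in>J. M p m * (N m q * x q))"
    by (simp add: mat_vec_def sum_distrib_left)
  also have "\<dots> = mat_vec J (mat_mul K M N) x p"
    by (subst sum.swap) (simp add: mat_vec_def mat_mul_def sum_distrib_right mult.assoc)
  finally show ?thesis .
qed

lemma mat_vec_eq: "mat_eq R K M N \<Longrightarrow> p \<in> R \<Longrightarrow> mat_vec K M x p = mat_vec K N x p"
  by (simp add: mat_vec_def mat_eq_def)

lemma mat_vec_id: "finite K \<Longrightarrow> p \<in> K \<Longrightarrow> mat_vec K mat_id x p = x p"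
  by (simp add: mat_vec_def mat_id_def if_distrib[of "\<lambda>x. x * _"] cong: if_cong)

lemma sum_mat_id: "finite J \<Longrightarrow> i \<in> J \<Longrightarrow> (\<Sum>j\<in>J. mat_id i j * f j) = f i"
  by (simp add: mat_id_def if_distrib[of "\<lambda>x. x * _"] cong: if_cong)

context scattering_network
begin

text \<open>
  With \<open>u = (S, \<alpha>, e\<^bsup>-ika\<^esup> \<beta>)\<close> one has \<open>X (S, \<alpha>, \<beta>) = u + transfer u\<close> and
  \<open>Y (S, \<alpha>, \<beta>) = u - transfer u\<close>, so \<open>Z (S, \<alpha>, \<beta>) = (A + ikB) u + (A - ikB) transfer u\<close>.
\<close>

fun rephase :: "real \<Rightarrow> ('i \<Rightarrow> real) \<Rightarrow> (('i, 'e) basis, 'e) cmat \<Rightarrow> 'e \<Rightarrow> ('i, 'e) basis \<Rightarrow> complex"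
  where
    "rephase k a T e' (KE e) = T (KE e) e'"
  | "rephase k a T e' (KIm i) = T (KIm i) e'"
  | "rephase k a T e' (KIp i) = cis (- (k * a i)) * T (KIp i) e'"

lemma X_Y_mat_rephase:
  assumes m: "m \<in> K"
  shows "(\<Sum>q\<in>K. X_mat k a m q * T q e') = rephase k a T e' m + transfer k a (rephase k a T e') m"
    and "(\<Sum>q\<in>K. Y_mat k a m q * T q e') = rephase k a T e' m - transfer k a (rephase k a T e') m"
proof -
  have exp: "exp (\<i> * complex_of_real t) = cis t" "exp (- (\<i> * complex_of_real t)) = cis (- t)" for t
    by (simp_all add: cis_conv_exp)
  have inv: "cis (k * a i) * (cis (- (k * a i)) * z) = z" for i z
    by (simp add: mult.assoc[symmetric] cis_mult)
  note row = sum_K X_mat.simps Y_mat.simps mult_zero_left sum.neutral_const add_0_left add_0_right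
    sum.distrib mult.assoc mult_minus_left sum_negf exp
  have "(\<Sum>q\<in>K. X_mat k a m q * T q e') = rephase k a T e' m + transfer k a (rephase k a T e') m \<and>
    (\<Sum>q\<in>K. Y_mat k a m q * T q e') = rephase k a T e' m - transfer k a (rephase k a T e') m"
  proof (cases m)
    case (KE e)
    with m have "e \<in> external G" by simp
    note sum_mat_id[OF finite_lines(2) this, simp]
    show ?thesis unfolding KE by (simp only: row) simp
  next
    case (KIm i)
    with m have "i \<in> I" by simp
    note sum_mat_id[OF finite_lines(1) this, simp]
    show ?thesis unfolding KIm by (simp only: row) (simp add: inv)
  next
    case (KIp i)
    with m have "i \<in> I" by simp
    note sum_mat_id[OF finite_lines(1) this, simp]
    show ?thesis unfolding KIp by (simp only: row) simp
  qed
  then show "(\<Sum>q\<in>K. X_mat k a m q * T q e') = rephase k a T e' m + transfer k a (rephase k a T e') m"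
    and "(\<Sum>q\<in>K. Y_mat k a m q * T q e') = rephase k a T e' m - transfer k a (rephase k a T e') m"
    by simp_all
qed

lemma Z_mat_rephase:
  fixes A B :: "(('i, 'e) basis, ('i, 'e) basis) cmat" and a :: "'i \<Rightarrow> real"
    and T :: "(('i, 'e) basis, 'e) cmat" and k :: real and e' :: 'e
  defines "u \<equiv> rephase k a T e'"
  shows "mat_mul K (Z_mat G k A B a) T p e'
    = mat_vec K (\<lambda>p q. A p q + \<i> * complex_of_real k * B p q) u p
      + mat_vec K (\<lambda>p q. A p q - \<i> * complex_of_real k * B p q) (transfer k a u) p"
proof -
  have swap: "(\<Sum>q\<in>K. mat_mul K M N p q * T q e') = mat_vec K M (\<lambda>m. \<Sum>q\<in>K. N m q * T q e') p"
    for M N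
    using mat_vec_mul[of K M K N "\<lambda>q. T q e'" p] by (simp add: mat_vec_def)
  have "mat_mul K (Z_mat G k A B a) T p e'
    = (\<Sum>q\<in>K. mat_mul K A (X_mat k a) p q * T q e')
      + \<i> * complex_of_real k * (\<Sum>q\<in>K. mat_mul K B (Y_mat k a) p q * T q e')"
    by (simp add: mat_mul_def[of K "Z_mat G k A B a"] Z_mat_def distrib_right sum.distrib
        sum_distrib_left mult.assoc)
  also have "\<dots> = mat_vec K A (\<lambda>m. u m + transfer k a u m) p
      + \<i> * complex_of_real k * mat_vec K B (\<lambda>m. u m - transfer k a u m) p"
    unfolding swap u_def using X_Y_mat_rephase by (simp cong: mat_vec_cong)
  also have "\<dots> = mat_vec K (\<lambda>p q. A p q + \<i> * complex_of_real k * B p q) u p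
      + mat_vec K (\<lambda>p q. A p q - \<i> * complex_of_real k * B p q) (transfer k a u) p"
    by (simp add: mat_vec_def sum_distrib_left sum.distrib[symmetric] algebra_simps)
  finally show ?thesis .
qed

context
  fixes A B N :: "(('i, 'e) basis, ('i, 'e) basis) cmat" and k :: real
  assumes inverse: "is_mat_inv K (\<lambda>p q. A p q + \<i> * complex_of_real k * B p q) N"
    and scatter: "mat_eq K K (mat_mul K (\<lambda>p q. A p q + \<i> * complex_of_real k * B p q) S)
      (\<lambda>p q. - (A p q - \<i> * complex_of_real k * B p q))"
begin

text \<open>By \<open>scatter\<close>, \<open>A - ikB\<close> is minus \<open>A + ikB\<close> times
  \<open>S\<close>. After rephasing, both sides of the equation thus carry the factor
  \<open>A + ikB\<close>, which \<open>N\<close> cancels.\<close>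

lemma scattering_column_iff_amplitude:
  assumes e': "e' \<in> external G"
  shows "(\<forall>p\<in>K. mat_mul K (Z_mat G k A B a) T p e'
      = - mat_mul K (\<lambda>p q. A p q - \<i> * complex_of_real k * B p q) (\<lambda>p e'. mat_id p (KE e')) p e')
    \<longleftrightarrow> amplitude k a e' 1 (rephase k a T e')"
proof -
  let ?M = "\<lambda>p q. A p q + \<i> * complex_of_real k * B p q"
  let ?M' = "\<lambda>p q. A p q - \<i> * complex_of_real k * B p q"
  let ?u = "rephase k a T e'"
  let ?y = "\<lambda>q. mat_id q (KE e') + complex_of_real 1 * transfer k a ?u q"
  have y: "mat_vec K ?M (mat_vec K S ?y) p = - (mat_mul K ?M' (\<lambda>p e'. mat_id p (KE e')) p e'
      + mat_vec K ?M' (transfer k a ?u) p)" if "p \<in> K" for p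
  proof -
    have "mat_vec K ?M (mat_vec K S ?y) p = mat_vec K (\<lambda>p q. - ?M' p q) ?y p"
      unfolding mat_vec_mul by (rule mat_vec_eq[OF scatter that])
    also have "\<dots> = - (mat_mul K ?M' (\<lambda>p e'. mat_id p (KE e')) p e'
        + mat_vec K ?M' (transfer k a ?u) p)"
      by (simp add: mat_vec_def mat_mul_def sum.distrib[symmetric] sum_negf[symmetric] algebra_simps)
    finally show ?thesis .
  qed
  have "(\<forall>p\<in>K. mat_mul K (Z_mat G k A B a) T p e'
      = - mat_mul K ?M' (\<lambda>p e'. mat_id p (KE e')) p e')
    \<longleftrightarrow> (\<forall>p\<in>K. mat_vec K ?M ?u p = mat_vec K ?M (mat_vec K S ?y) p)"
    by (intro ball_cong refl) (simp only: Z_mat_rephase y eq_neg_iff_add_eq_0 add.assoc add.commute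
        add.left_commute)
  also have "\<dots> \<longleftrightarrow> (\<forall>p\<in>K. ?u p = mat_vec K S ?y p)"
  proof
    assume eq: "\<forall>p\<in>K. mat_vec K ?M ?u p = mat_vec K ?M (mat_vec K S ?y) p"
    have NM: "mat_vec K N (mat_vec K ?M x) p = x p" if "p \<in> K" for x p
      unfolding mat_vec_mul
      using mat_vec_eq[of K K "mat_mul K N ?M" mat_id p x] inverse that finite_K
      by (simp add: is_mat_inv_def mat_vec_id)
    have eq': "mat_vec K N (mat_vec K ?M ?u) = mat_vec K N (mat_vec K ?M (mat_vec K S ?y))"
      using eq by (intro mat_vec_cong) blast
    show "\<forall>p\<in>K. ?u p = mat_vec K S ?y p"
    proof
      fix p assume "p \<in> K"
      from fun_cong[OF eq', of p] show "?u p = mat_vec K S ?y p"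
        by (simp only: NM[OF \<open>p \<in> K\<close>])
    qed
  next
    assume "\<forall>p\<in>K. ?u p = mat_vec K S ?y p"
    then have "mat_vec K ?M ?u = mat_vec K ?M (mat_vec K S ?y)"
      by (intro mat_vec_cong) blast
    then show "\<forall>p\<in>K. mat_vec K ?M ?u p = mat_vec K ?M (mat_vec K S ?y) p" by simp
  qed
  finally show ?thesis by (simp only: amplitude_def)
qed

text \<open>The choice in \<open>scattering_matrix\<close> is a genuine solution because one exists:
  each column is solved as a fixed point equation. Rephasing leaves the external rows
  unchanged.\<close>

lemma scattering_matrix_amplitude:
  obtains u where "\<And>a e'. e' \<in> external G \<Longrightarrow> amplitude k a e' 1 (u a e')"
    and "\<And>a e e'. scattering_matrix G k A B a e e' = u a e' (KE e)"
proof -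
  define T where "T a = (SOME T. is_scattering_solution G k A B a T)" for a
  have iff: "is_scattering_solution G k A B a T
    \<longleftrightarrow> (\<forall>e'\<in>external G. amplitude k a e' 1 (rephase k a T e'))" for a T
    unfolding is_scattering_solution_def mat_eq_def
    using scattering_column_iff_amplitude by blast
  have "\<exists>T. is_scattering_solution G k A B a T" for a
  proof -
    obtain v where v: "\<forall>e'\<in>external G. amplitude k a e' 1 (v e')"
      using bchoice[of "external G" "\<lambda>e'. amplitude k a e' 1"] amplitude_exists by blast
    \<comment> \<open>Multiplying the \<open>KIp\<close> rows by this phase undoes
      \<open>rephase\<close>.\<close>
    define T where "T p e' = (case p of KIp i \<Rightarrow> cis (k * a i) * v e' p | _ \<Rightarrow> v e' p)" for p e'
    have "rephase k a T e' p = v e' p" for e' p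
      by (cases p) (simp_all add: T_def mult.assoc[symmetric] cis_mult)
    then have "rephase k a T e' = v e'" for e' by (rule ext)
    then have "is_scattering_solution G k A B a T" using v iff by simp
    then show ?thesis by blast
  qed
  then have "is_scattering_solution G k A B a (T a)" for a
    unfolding T_def by (rule someI_ex)
  then have "amplitude k a e' 1 (rephase k a (T a) e')" if "e' \<in> external G" for a e'
    using iff that by blast
  then show ?thesis
    by (intro that[of "\<lambda>a. rephase k a (T a)"]) (simp_all add: scattering_matrix_def T_def)
qed

end

end

text \<open>Compared with \<open>walk_vertices\<close> the condition on the final vertex is dropped,
  so that initial segments are again of this kind and induction can append one line at a
  time.\<close>

definition path_vertices :: "('v, 'i, 'e) line_graph \<Rightarrow> 'e \<Rightarrow> 'i list \<Rightarrow> 'v list \<Rightarrow> bool" where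
  "path_vertices G e' is vs \<longleftrightarrow>
     length vs = length is + 1 \<and> vs ! 0 = attach G e' \<and>
     (\<forall>p < length is.
        vs ! p \<in> end_points G (is ! p) \<and> vs ! (p + 1) \<in> end_points G (is ! p) \<and>
        vs ! p \<noteq> vs ! (p + 1))"

lemma last_path_vertices: "path_vertices G e' is vs \<Longrightarrow> last vs = vs ! length is"
  by (cases vs rule: rev_cases) (auto simp: path_vertices_def nth_append)

lemma walk_vertices_iff:
  "walk_vertices G (e', is, e) vs \<longleftrightarrow> path_vertices G e' is vs \<and> last vs = attach G e"
  using last_path_vertices[of G e' "is" vs] by (auto simp: path_vertices_def)

lemma path_vertices_Nil: "path_vertices G e' [] vs \<longleftrightarrow> vs = [attach G e']"
  by (cases vs) (auto simp: path_vertices_def)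

lemma path_vertices_snoc:
  "path_vertices G e' (is @ [i]) vs \<longleftrightarrow>
    (\<exists>ws v. vs = ws @ [v] \<and> path_vertices G e' is ws \<and>
      last ws \<in> end_points G i \<and> v \<in> end_points G i \<and> last ws \<noteq> v)"
proof (cases vs rule: rev_cases)
  case (snoc ws v)
  show ?thesis
  proof (cases "length ws = length is + 1")
    case True
    then have "ws \<noteq> []" by auto
    with True have "last ws = ws ! length is" by (simp add: last_conv_nth)
    moreover have "path_vertices G e' (is @ [i]) vs \<longleftrightarrow> path_vertices G e' is ws \<and>
        ws ! length is \<in> end_points G i \<and> v \<in> end_points G i \<and> ws ! length is \<noteq> v"
    proof -
      have "vs ! p = ws ! p" if "p \<le> length is" for p
        using that True snoc by (simp add: nth_append)
      moreover have "vs ! Suc (length is) = v" "length vs = length is + 2"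
        using True snoc by (simp_all add: nth_append)
      moreover have "(is @ [i]) ! p = is ! p" if "p < length is" for p
        using that by (simp add: nth_append)
      ultimately show ?thesis using True
        by (simp add: path_vertices_def All_less_Suc Suc_le_eq) blast
    qed
    ultimately show ?thesis using snoc by simp
  next
    case False
    then show ?thesis using snoc by (auto simp: path_vertices_def)
  qed
qed (auto simp: path_vertices_def)

text \<open>The next vertex is forced: it is the end point of the line other than the current
  vertex.\<close>

lemma path_vertices_unique:
  "path_vertices G e' is vs \<Longrightarrow> path_vertices G e' is ws \<Longrightarrow> vs = ws"
proof (induction "is" arbitrary: vs ws rule: rev_induct)
  case (snoc i "is")
  then obtain vs' v ws' w where
    "vs = vs' @ [v]" "path_vertices G e' is vs'" "last vs' \<in> end_points G i" "v \<in> end_points G i"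
    "last vs' \<noteq> v" "ws = ws' @ [w]" "path_vertices G e' is ws'" "w \<in> end_points G i" "last ws' \<noteq> w"
    unfolding path_vertices_snoc by blast
  moreover from this have "vs' = ws'" using snoc.IH by blast
  ultimately show ?case by (auto simp: end_points_def)
qed (simp add: path_vertices_Nil)

text \<open>The outgoing line \<open>l\<close> is left arbitrary. It may be internal, so that an
  initial segment of a walk has a weight including the scattering into the next line.\<close>

definition path_weight ::
  "('v, 'i, 'e) line_graph \<Rightarrow> ('v \<Rightarrow> (('i, 'e) basis, ('i, 'e) basis) cmat) \<Rightarrow> 'e \<Rightarrow> 'i list \<Rightarrow>
    'v list \<Rightarrow> ('i, 'e) line \<Rightarrow> complex" where
  "path_weight G V e' is vs l = (let ls = ELine e' # map ILine is @ [l] in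
     \<Prod>p<length vs. V (vs ! p) (line_basis G (vs ! p) (ls ! (p + 1))) (line_basis G (vs ! p) (ls ! p)))"

lemma path_weight_snoc:
  assumes "length ws = length is + 1"
  shows "path_weight G V e' (is @ [i]) (ws @ [v]) l
    = path_weight G V e' is ws (ILine i) * V v (line_basis G v l) (line_basis G v (ILine i))"
proof -
  let ?ls = "ELine e' # map ILine (is @ [i]) @ [l]" and ?ks = "ELine e' # map ILine is @ [ILine i]"
  have eq: "?ls ! p = ?ks ! p" if "p \<le> length ws" for p
    using that assms by (simp add: nth_Cons nth_append split: nat.split)
  have "(\<Prod>p<length ws. V ((ws @ [v]) ! p) (line_basis G ((ws @ [v]) ! p) (?ls ! (p + 1)))
      (line_basis G ((ws @ [v]) ! p) (?ls ! p)))
    = (\<Prod>p<length ws. V (ws ! p) (line_basis G (ws ! p) (?ks ! (p + 1))) (line_basis G (ws ! p) (?ks ! p)))"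
  proof (intro prod.cong refl)
    fix p assume "p \<in> {..<length ws}"
    then have "(ws @ [v]) ! p = ws ! p" "?ls ! p = ?ks ! p" "?ls ! (p + 1) = ?ks ! (p + 1)"
      using eq[of p] eq[of "p + 1"] by (simp_all add: nth_append)
    then show "V ((ws @ [v]) ! p) (line_basis G ((ws @ [v]) ! p) (?ls ! (p + 1)))
        (line_basis G ((ws @ [v]) ! p) (?ls ! p))
      = V (ws ! p) (line_basis G (ws ! p) (?ks ! (p + 1))) (line_basis G (ws ! p) (?ks ! p))"
      by (simp only:)
  qed
  moreover have "?ls ! (length ws + 1) = l" "?ls ! length ws = ILine i"
    using assms by (simp_all add: nth_append)
  ultimately show ?thesis
    by (simp add: path_weight_def Let_def)
qed

lemma walk_weight_eq_path_weight:
  assumes "walk_vertices G (e', is, e) vs"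
  shows "walk_weight G k Av Bv (e', is, e)
    = path_weight G (vertex_scattering_matrix G k Av Bv) e' is vs (ELine e)"
proof -
  have "(THE vs. walk_vertices G (e', is, e) vs) = vs"
  proof (rule the_equality[where P = "walk_vertices G (e', is, e)", OF assms])
    fix ws assume "walk_vertices G (e', is, e) ws"
    then show "ws = vs" using assms path_vertices_unique unfolding walk_vertices_iff by metis
  qed
  then show ?thesis by (simp only: walk_weight_def path_weight_def Let_def walk_lines.simps)
qed

section \<open>Identification of word amplitudes with walk weights\<close>

context scattering_network
begin

context
  fixes V :: "'v \<Rightarrow> (('i, 'e) basis, ('i, 'e) basis) cmat"
  assumes S_local: "S = vertex_sum G V"
    and loopfree: "\<And>i. i \<in> I \<Longrightarrow> tail (internal G) i \<noteq> head (internal G) i"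
begin

lemma S_eq:
  "S p q = (if basis_vertex G p = basis_vertex G q then V (basis_vertex G p) p q else 0)"
  by (subst S_local) (simp add: vertex_sum_def)

text \<open>
  \<open>S_eq\<close> as a rewrite rule eta-contracts to an equation for \<open>S\<close> itself, which is a hidden argument of
  \<open>word_amplitude\<close>.
\<close>

lemmas S_rewrites = S_eq[of _ "KE _"] S_eq[of _ "KIm _"] S_eq[of _ "KIp _"]

text \<open>Locality kills the term of the recursion in which the last line does not end at the
  vertex of \<open>p\<close>, so at most one vertex sequence contributes. The value and the
  vanishing claim are proved together because both are needed for the shorter word. Words list the
  last line first, hence \<open>rev\<close>.\<close>

lemma word_amplitude_path:
  assumes "set is \<subseteq> I"
  shows "(\<forall>ws l. path_vertices G e' is ws \<longrightarrow> basis_vertex G p = last ws \<longrightarrow>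
        line_basis G (last ws) l = p \<longrightarrow>
        word_amplitude e' (rev is) p = path_weight G V e' is ws l) \<and>
    ((\<forall>ws. path_vertices G e' is ws \<longrightarrow> last ws \<noteq> basis_vertex G p) \<longrightarrow>
      word_amplitude e' (rev is) p = 0)"
  using assms
proof (induction "is" arbitrary: p rule: rev_induct)
  case Nil
  show ?case by (auto simp: path_vertices_Nil S_rewrites path_weight_def)
next
  case (snoc i "is")
  then have sub: "set is \<subseteq> I" and i: "tail (internal G) i \<noteq> head (internal G) i"
    using loopfree by auto
  have weight: "word_amplitude e' (rev is) q = path_weight G V e' is ws l"
    if "path_vertices G e' is ws" "basis_vertex G q = last ws" "line_basis G (last ws) l = q" for ws l q
    using snoc.IH[OF sub, of q] that by blast
  have zero: "word_amplitude e' (rev is) q = 0"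
    if "\<And>ws. path_vertices G e' is ws \<Longrightarrow> last ws \<noteq> basis_vertex G q" for q
    using snoc.IH[OF sub, of q] that by blast
  show ?case
  proof (intro conjI allI impI)
    fix vs l
    assume "path_vertices G e' (is @ [i]) vs" and p: "basis_vertex G p = last vs"
      and l: "line_basis G (last vs) l = p"
    then obtain ws v where vs: "vs = ws @ [v]" and ws: "path_vertices G e' is ws"
      and ends: "last ws \<in> end_points G i" "v \<in> end_points G i" "last ws \<noteq> v"
      by (auto simp: path_vertices_snoc)
    have len: "length ws = length is + 1" using ws by (simp add: path_vertices_def)
    from ends consider "v = tail (internal G) i" "last ws = head (internal G) i"
      | "v = head (internal G) i" "last ws = tail (internal G) i"
      by (auto simp: end_points_def)
    then show "word_amplitude e' (rev (is @ [i])) p = path_weight G V e' (is @ [i]) vs l"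
    proof cases
      case 1
      \<comment> \<open>The line \<open>i\<close> is left at its tail, so it was entered at its
        head, where its basis vector is \<open>KIp i\<close>. The term entered at the tail drops out
        by locality.\<close>
      with i have "word_amplitude e' (rev is) (KIp i) = path_weight G V e' is ws (ILine i)"
        by (intro weight ws) auto
      with 1 i p l show ?thesis
        unfolding vs path_weight_snoc[OF len] by (simp add: vs S_rewrites)
    next
      case 2
      with i have "word_amplitude e' (rev is) (KIm i) = path_weight G V e' is ws (ILine i)"
        by (intro weight ws) auto
      with 2 i p l show ?thesis
        unfolding vs path_weight_snoc[OF len] by (simp add: vs S_rewrites)
    qed
  next
    assume no: "\<forall>vs. path_vertices G e' (is @ [i]) vs \<longrightarrow> last vs \<noteq> basis_vertex G p"
    \<comment> \<open>A path reaching the opposite end of \<open>i\<close> could be continued along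
      \<open>i\<close> to the vertex of \<open>p\<close>, which is excluded.\<close>
    have no': False if "path_vertices G e' is ws" "last ws \<in> end_points G i"
      "basis_vertex G p \<in> end_points G i" "last ws \<noteq> basis_vertex G p" for ws
      using no that unfolding path_vertices_snoc by (metis last_snoc)
    have "S p (KIm i) * word_amplitude e' (rev is) (KIp i) = 0"
    proof (cases "basis_vertex G p = tail (internal G) i")
      case True
      then have "word_amplitude e' (rev is) (KIp i) = 0"
        using no' i by (intro zero) (auto simp: end_points_def)
      then show ?thesis by simp
    qed (simp add: S_rewrites)
    moreover have "S p (KIp i) * word_amplitude e' (rev is) (KIm i) = 0"
    proof (cases "basis_vertex G p = head (internal G) i")
      case True
      then have "word_amplitude e' (rev is) (KIm i) = 0"
        using no' i by (intro zero) (auto simp: end_points_def)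
      then show ?thesis by simp
    qed (simp add: S_rewrites)
    ultimately show "word_amplitude e' (rev (is @ [i])) p = 0"
      by (simp only: rev_append rev.simps append.simps word_amplitude.simps add_0_right)
  qed
qed

end

text \<open>Words that are not walks add zeros. Reversal does not change the score, so it permutes
  \<open>score_words\<close> and accounts for the opposite orders of words and walks.\<close>

lemma sum_walk_weights:
  assumes S: "S = global_scattering_matrix G k Av Bv"
    and loopfree: "\<And>i. i \<in> I \<Longrightarrow> tail (internal G) i \<noteq> head (internal G) i"
  shows "(\<Sum>w\<in>walks_with_score G e e' n. walk_weight G k Av Bv w)
    = (\<Sum>js\<in>score_words n. word_amplitude e' js (KE e))"
proof -
  let ?V = "vertex_scattering_matrix G k Av Bv"
  let ?P = "\<lambda>is. \<exists>vs. walk_vertices G (e', is, e) vs"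
  note word = word_amplitude_path[OF S[unfolded global_scattering_matrix_def] loopfree]
  have walks: "walks_with_score G e e' n = (\<lambda>is. (e', is, e)) ` {is \<in> score_words n. ?P is}"
    by (auto simp: walks_with_score_def walks_def score_words_def)
  have "(\<Sum>w\<in>walks_with_score G e e' n. walk_weight G k Av Bv w)
    = (\<Sum>is\<in>{is \<in> score_words n. ?P is}. walk_weight G k Av Bv (e', is, e))"
    unfolding walks by (subst sum.reindex) (auto simp: inj_on_def)
  also have "\<dots> = (\<Sum>is\<in>{is \<in> score_words n. ?P is}. word_amplitude e' (rev is) (KE e))"
  proof (intro sum.cong refl)
    fix "is" assume "is \<in> {is \<in> score_words n. ?P is}"
    then obtain vs where sub: "set is \<subseteq> I" and vs: "walk_vertices G (e', is, e) vs"
      by (auto simp: score_words_def)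
    have "word_amplitude e' (rev is) (KE e) = path_weight G ?V e' is vs (ELine e)"
      using word[OF _ sub, of e' "KE e"] vs unfolding walk_vertices_iff by simp
    then show "walk_weight G k Av Bv (e', is, e) = word_amplitude e' (rev is) (KE e)"
      using walk_weight_eq_path_weight[OF vs] by simp
  qed
  also have "\<dots> = (\<Sum>is\<in>score_words n. word_amplitude e' (rev is) (KE e))"
  proof (rule sum.mono_neutral_left[OF finite_score_words])
    show "\<forall>is\<in>score_words n - {is \<in> score_words n. ?P is}. word_amplitude e' (rev is) (KE e) = 0"
    proof
      fix "is" assume "is \<in> score_words n - {is \<in> score_words n. ?P is}"
      then have "set is \<subseteq> I" "\<not> ?P is" by (auto simp: score_words_def)
      then show "word_amplitude e' (rev is) (KE e) = 0"
        using word[of "is" e' "KE e"] unfolding walk_vertices_iff by auto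
    qed
  qed auto
  also have "\<dots> = (\<Sum>js\<in>rev ` score_words n. word_amplitude e' js (KE e))"
    by (subst sum.reindex) (auto simp: inj_on_def)
  also have "rev ` score_words n = score_words n"
  proof -
    have "rev js \<in> score_words n" if "js \<in> score_words n" for js
      using that by (simp add: score_words_def)
    then show ?thesis by (metis image_eqI image_subsetI rev_rev_ident subsetI subset_antisym)
  qed
  finally show ?thesis .
qed

end

theorem theorem4p10:
  fixes G :: "('v, 'i, 'e) line_graph"
    and A B C :: "(('i, 'e) basis, ('i, 'e) basis) cmat"
    and Av Bv :: "'v \<Rightarrow> (('i, 'e) basis, ('i, 'e) basis) cmat"
    and k :: real and n :: "'i \<Rightarrow> int" and e e' :: 'e
  assumes "no_tadpole_graph G" and "connected_graph G" and "noncompact_graph G"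
    and "local_bc G A B C Av Bv"
    and "mat_rank (basis_set G) (basis_set G <+> basis_set G) (mat_beside A B)
           = card (basis_set G)"
    and "self_adjoint (basis_set G) (mat_mul (basis_set G) A (mat_adj B))"
    and "k > 0"
    and "e \<in> external G" and "e' \<in> external G"
  shows "(walks_with_score G e e' n \<noteq> {} \<longrightarrow>
            fourier_coefficient G k A B n e e'
              = (\<Sum>w\<in>walks_with_score G e e' n. walk_weight G k Av Bv w)) \<and>
         (walks_with_score G e e' n = {} \<longrightarrow> fourier_coefficient G k A B n e e' = 0)"
proof -
  have fin: "finite (basis_set G)" by (rule finite_basis_set[OF assms(1)])
  obtain N where N: "is_mat_inv (basis_set G) (\<lambda>p q. A p q + \<i> * complex_of_real k * B p q) N"
    using boundary_matrix_invertible[OF fin assms(5,6), of k] \<open>k > 0\<close> by auto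
  interpret scattering_network G "global_scattering_matrix G k Av Bv"
  proof
    show "finite (arcs (internal G))" "finite (external G)"
      using assms(1) by (auto simp: no_tadpole_graph_def fin_digraph.finite_arcs)
  qed (rule global_scattering_matrix_unitary[OF fin assms(4) N assms(6)])
  have loopfree: "tail (internal G) i \<noteq> head (internal G) i" if "i \<in> arcs (internal G)" for i
    using assms(1) that loopfree_digraph.no_loops by (fastforce simp: no_tadpole_graph_def)
  obtain u where u: "\<And>a e'. e' \<in> external G \<Longrightarrow> amplitude k a e' 1 (u a e')"
    and S: "\<And>a e e'. scattering_matrix G k A B a e e' = u a e' (KE e)"
    using scattering_matrix_amplitude[OF N global_scattering_matrix_eq[OF fin assms(4) N]] by metis
  have "fourier_coefficient G k A B n e e' = complex_of_real ((k / (2 * pi)) ^ card I) *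
      (complex_of_real ((2 * pi / k) ^ card I) * (\<Sum>js\<in>score_words n. word_amplitude e' js (KE e)))"
    unfolding fourier_coefficient_def S
    by (subst amplitude_fourier[OF assms(7-9) u[OF assms(9)]]) simp
  \<comment> \<open>The normalizing factor is the reciprocal of the volume of the box.\<close>
  also have "\<dots> = (\<Sum>js\<in>score_words n. word_amplitude e' js (KE e))"
    using \<open>k > 0\<close> by (simp add: mult.assoc[symmetric] power_mult_distrib[symmetric])
  also have "\<dots> = (\<Sum>w\<in>walks_with_score G e e' n. walk_weight G k Av Bv w)"
    by (rule sum_walk_weights[OF refl loopfree, symmetric])
  \<comment> \<open>When there are no walks the sum is empty, so one equation covers both
    cases.\<close>
  finally show ?thesis by simp
qed

end
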